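(* Every lobster admits an antimagic orientation.
   Context: All graphs are finite and simple. For a graph $G$ with $m\ge 1$ edges, an antimagic orientation of $G$ is a pair $(D,\tau)$ where $D$ is an orientation of $G$ and $\tau: A(D)\to\{1,2,\dots,m\}$ is a bijection such that no two distinct vertices of $D$ have the same vertex-sum, where the vertex-sum of a vertex $u$ is the sum of the labels of all arcs entering $u$ minus the sum of the labels of all arcs leaving $u$. A caterpillar is a tree of order at least $3$ such that removing all its leaves (vertices of degree one) produces a path. A lobster is a tree such that removing all its leaves produces a caterpillar. *)

theory Defs
  imports "Graph_Theory.Graph_Theory"
begin

text \<open>
  A finite simple graph is a symmetric, loop-free digraph without parallel arcs (locale
  \<^locale>\<open>graph\<close>): an undirected edge uv is the pair of opposite arcs from u to v and
  from v to u.
\<close>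

definition undirected_edges :: "('a, 'b) pre_digraph \<Rightarrow> 'a set set" where
  "undirected_edges G = (\<lambda>(u, v). {u, v}) ` arcs_ends G"

text \<open>
  The library's \<^const>\<open>tree\<close> cannot be used for symmetric digraphs: there \<^const>\<open>pre_digraph.cycle\<close>
  also holds of the closed walk u, v, u along a single edge. Undirected cycles are exactly
  the library's cycles of length at least 3.
\<close>

definition undirected_tree :: "('a, 'b) pre_digraph \<Rightarrow> bool" where
  "undirected_tree G \<longleftrightarrow>
     graph G \<and> connected G \<and> (\<nexists>p. pre_digraph.cycle G p \<and> 3 \<le> length p)"

text \<open>In a symmetric digraph, the degree of a vertex is its out-degree.\<close>

definition leaves :: "('a, 'b) pre_digraph \<Rightarrow> 'a set" where
  "leaves G = {v \<in> verts G. out_degree G v = 1}"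

definition remove_leaves :: "('a, 'b) pre_digraph \<Rightarrow> ('a, 'b) pre_digraph" where
  "remove_leaves G = G \<restriction> (verts G - leaves G)"

text \<open>The one-vertex graph is a path, so that stars with at least two edges are caterpillars.\<close>

definition path_graph :: "('a, 'b) pre_digraph \<Rightarrow> bool" where
  "path_graph G \<longleftrightarrow> graph G \<and>
     (\<exists>vs. vs \<noteq> [] \<and> distinct vs \<and> set vs = verts G \<and>
        undirected_edges G = {{vs ! i, vs ! Suc i} | i. Suc i < length vs})"

definition caterpillar :: "('a, 'b) pre_digraph \<Rightarrow> bool" where
  "caterpillar G \<longleftrightarrow>
     undirected_tree G \<and> 3 \<le> card (verts G) \<and> path_graph (remove_leaves G)"

definition lobster :: "('a, 'b) pre_digraph \<Rightarrow> bool" where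
  "lobster G \<longleftrightarrow> undirected_tree G \<and> caterpillar (remove_leaves G)"

definition orientation :: "('a, 'b) pre_digraph \<Rightarrow> ('a, 'b) pre_digraph \<Rightarrow> bool" where
  "orientation G D \<longleftrightarrow> spanning D G \<and>
     (\<forall>(u, v) \<in> arcs_ends G. ((u, v) \<in> arcs_ends D) \<noteq> ((v, u) \<in> arcs_ends D))"

definition vertex_sum :: "('a, 'b) pre_digraph \<Rightarrow> ('b \<Rightarrow> nat) \<Rightarrow> 'a \<Rightarrow> int" where
  "vertex_sum D \<tau> u =
     (\<Sum>e \<in> in_arcs D u. int (\<tau> e)) - (\<Sum>e \<in> out_arcs D u. int (\<tau> e))"

definition antimagic_orientation ::
    "('a, 'b) pre_digraph \<Rightarrow> ('a, 'b) pre_digraph \<Rightarrow> ('b \<Rightarrow> nat) \<Rightarrow> bool" where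
  "antimagic_orientation G D \<tau> \<longleftrightarrow>
     orientation G D \<and>
     bij_betw \<tau> (arcs D) {1..card (undirected_edges G)} \<and>
     inj_on (vertex_sum D \<tau>) (verts D)"

end

theory Submission
  imports Defs
begin

text \<open>
  Removing the leaves twice leaves a path. Lengthen it at both ends by a vertex of the caterpillar
  and call it the spine. Small labels go to leaves, larger ones to the edges between the spine
  and its non-leaf neighbours \<open>W\<close>, and the largest to the spine. A leaf has its label as
  absolute value. A vertex \<open>w\<close> of \<open>W\<close> has the label of its spine edge plus a signed sum of leaf
  labels as absolute value; one leaf of \<open>w\<close> is labelled last, in the order of the
  partial sums, so these values become distinct whatever the signs of the spine edges are.
  This leaves the signs free at the spine, where the children are cancelled in pairs with adjacent
  labels. If nothing is left over, the orientation of the spine turns, and the vertex gets an absolute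
  value above almost everything else. Otherwise the orientation passes through with contribution
  \<open>1\<close>, and the value is essentially the sum of the one or two labels left over, which are again
  assigned in the order of the partial sums. The order of the intervals of labels separates the
  kinds of vertices from one another. The two ends of the spine need extra care.
\<close>

subsection \<open>Labels in prescribed intervals\<close>

text \<open>Turns are forced: passing contributes 1 and the cancelled pairs at most one unit more or
  less, so a spine vertex with nothing left over would have a value in {0, 1, 2}, and many such
  vertices would collide. At a turn the two spine labels add up instead.

  Intervals alone cannot separate everything: with one label left over, the value of a spine vertex
  falls among the absolute values of leaves or of \<open>W\<close>. There the sign decides. A
  left-over child of an inner spine vertex has its edge directed to the spine, so that its label
  counts positively at the spine and negatively at the child; positive values off the spine then
  involve labels from other intervals.

  The signs in \<open>W\<close> are dictated by the cancellation at the spine. The leaves of a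
  vertex of \<open>W\<close> must therefore cope with either sign: all but one are balanced to a sum
  of at most \<open>D\<close> in absolute value, and the last one has a label above
  \<open>D\<close>.\<close>

lemma ex_labels_sum_inj:
  fixes key :: "'c \<Rightarrow> int" and b :: int
  assumes "finite X"
  shows "\<exists>lab. bij_betw lab X {b+1..b + int (card X)} \<and> inj_on (\<lambda>x. key x + lab x) X"
  using assms
proof (induction "card X" arbitrary: X)
  case 0
  then have "X = {}" by simp
  then show ?case by (auto simp: bij_betw_def)
next
  case (Suc n)
  then have "X \<noteq> {}" by auto
  with Suc.prems have "Max (key ` X) \<in> key ` X" by simp
  then obtain m where m: "m \<in> X" "key m = Max (key ` X)" by auto
  then have mx: "key x \<le> key m" if "x \<in> X" for x using Suc.prems that by simp
  from m(1) Suc have c: "n = card (X - {m})" "card X = Suc (card (X - {m}))" by simp_all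
  from Suc.hyps(1)[OF c(1)] Suc.prems obtain lab where
    lab: "bij_betw lab (X - {m}) {b+1..b + int (card (X - {m}))}"
      "inj_on (\<lambda>x. key x + lab x) (X - {m})" by auto
  \<comment> \<open>A greatest key receives the greatest label, so the sums increase strictly in the
    order of assignment, also where keys agree.\<close>
  let ?l = "lab(m := b + int (card X))"
  have "bij_betw ?l (insert m (X - {m})) (insert (b + int (card X)) {b+1..b + int (card (X - {m}))})"
    using lab(1) c by (intro bij_betw_combine[of ?l "{m}" "{b + int (card X)}", simplified] bij_betw_cong[THEN iffD1, OF _ lab(1)]) auto
  moreover have "insert m (X - {m}) = X" using m by auto
  moreover have "insert (b + int (card X)) {b+1..b + int (card (X - {m}))} = {b+1..b + int (card X)}"
    using c by auto
  moreover have "inj_on (\<lambda>x. key x + ?l x) (insert m (X - {m}))"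
  proof -
    have "key x + lab x < key m + (b + int (card X))" if "x \<in> X - {m}" for x
      using mx[of x] bij_betwE[OF lab(1)] that c by force
    then show ?thesis using lab(2) by (fastforce simp: inj_on_def)
  qed
  ultimately show ?case by (intro exI[of _ ?l]) simp
qed

text \<open>Serves \<open>tA 0\<close>, whose contribution at the end 0 has to stay within one unit
  (see \<open>sval_0\<close>).\<close>

lemma ex_labels_from_one:
  assumes "finite X"
  shows "\<exists>lab. bij_betw lab X {1..int (card X)} \<and> (x \<in> X \<longrightarrow> lab x = 1)"
proof -
  obtain lab where lab: "bij_betw lab X {0+1..0+int (card X)}"
    using ex_labels_sum_inj[OF assms] by blast
  show ?thesis
  proof (cases "x \<in> X")
    case True
    then have "card X \<ge> 1" using assms by (metis One_nat_def Suc_leI card_gt_0_iff empty_iff)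
    then have "1 \<in> lab ` X" using lab by (auto simp: bij_betw_def)
    then obtain y where y: "y \<in> X" "lab y = 1" by auto
    have "bij_betw (transpose x y) X X" using True y(1) by simp
    then have "bij_betw (lab \<circ> transpose x y) X {1..int (card X)}"
      using lab by (simp add: bij_betw_trans)
    then show ?thesis using y by (intro exI[of _ "lab \<circ> transpose x y"]) simp
  qed (use lab in auto)
qed

text \<open>Two elements of the same class receive adjacent labels with opposite signs and
  contribute one unit. Its sign is chosen to move the sum of the class from 0 to
  \<open>\<epsilon> i\<close> or back, so the sum never leaves these two values.\<close>

lemma ex_paired_labels:
  fixes pos :: "'c \<Rightarrow> nat" and b :: int
  assumes "finite X" "\<And>i. even (card {x \<in> X. pos x = i})" "\<And>i. \<epsilon> i \<in> {1, -1::int}"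
  shows "\<exists>lab s. bij_betw lab X {b+1..b + int (card X)} \<and> (\<forall>x. s x \<in> {1, -1}) \<and>
    (\<forall>i. (\<Sum>x | x \<in> X \<and> pos x = i. s x * lab x) \<in> {0, \<epsilon> i})"
  using assms(1,2)
proof (induction "card X" arbitrary: X rule: less_induct)
  case less
  show ?case
  proof (cases "X = {}")
    case True
    then show ?thesis by (intro exI[of _ "\<lambda>_. 1"]) (auto simp: bij_betw_def)
  next
    case False
    then obtain x where x: "x \<in> X" by auto
    have "{z \<in> X. pos z = pos x} \<noteq> {x}"
      using less.prems(2)[of "pos x"] by auto
    then obtain y where y: "y \<in> X" "pos y = pos x" "y \<noteq> x" using x by blast
    let ?X = "X - {x, y}"
    have cX: "card X = card ?X + 2"
    proof -
      have "card X = card ({x, y} \<union> ?X)" using x y by (intro arg_cong[of _ _ card]) auto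
      also have "\<dots> = card {x, y} + card ?X" using less.prems(1) by (intro card_Un_disjoint) auto
      finally show ?thesis using y by simp
    qed
    have fib: "{z \<in> X. pos z = i} = {z \<in> ?X. pos z = i} \<union> (if i = pos x then {x, y} else {})" for i
      using x y by auto
    have "even (card {z \<in> ?X. pos z = i})" for i
    proof -
      have "card {z \<in> X. pos z = i} = card {z \<in> ?X. pos z = i} + (if i = pos x then 2 else 0)"
        unfolding fib using y less.prems(1) by (subst card_Un_disjoint) auto
      then show ?thesis using less.prems(2)[of i] by (auto split: if_splits)
    qed
    then obtain lab s where lab: "bij_betw lab ?X {b+1..b + int (card ?X)}"
      and s: "\<forall>x. s x \<in> {1, -1}"
      and sm: "\<forall>i. (\<Sum>x | x \<in> ?X \<and> pos x = i. s x * lab x) \<in> {0, \<epsilon> i}"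
      using less.hyps[of ?X] less.prems(1) cX by (smt (verit, ccfv_threshold) finite_Diff less_add_same_cancel1 zero_less_numeral)
    define c where "c = (if (\<Sum>z | z \<in> ?X \<and> pos z = pos x. s z * lab z) = 0 then \<epsilon> (pos x) else - \<epsilon> (pos x))"
    have c: "c \<in> {1, -1}" using assms(3)[of "pos x"] by (auto simp: c_def)
    define l where "l = lab(x := b + int (card ?X) + 1, y := b + int (card ?X) + 2)"
    define t where "t = s(x := - c, y := c)"
    have "bij_betw l ({x, y} \<union> ?X) ({b + int (card ?X) + 1, b + int (card ?X) + 2} \<union> {b+1..b + int (card ?X)})"
    proof (rule bij_betw_combine)
      show "bij_betw l {x, y} {b + int (card ?X) + 1, b + int (card ?X) + 2}"
        using y by (auto simp: bij_betw_def l_def)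
      show "bij_betw l ?X {b+1..b + int (card ?X)}"
        using lab by (rule bij_betw_cong[THEN iffD1, rotated]) (auto simp: l_def)
    qed auto
    moreover have "{x, y} \<union> ?X = X" using x y by auto
    moreover have "{b + int (card ?X) + 1, b + int (card ?X) + 2} \<union> {b+1..b + int (card ?X)} = {b+1..b + int (card X)}"
      unfolding cX by auto
    ultimately have "bij_betw l X {b+1..b + int (card X)}" by simp
    moreover have "\<forall>x. t x \<in> {1, -1}" using s c by (auto simp: t_def)
    moreover have "(\<Sum>z | z \<in> X \<and> pos z = i. t z * l z) \<in> {0, \<epsilon> i}" for i
    proof -
      have eq: "(\<Sum>z | z \<in> ?X \<and> pos z = i. t z * l z) = (\<Sum>z | z \<in> ?X \<and> pos z = i. s z * lab z)"
        by (intro sum.cong) (auto simp: t_def l_def)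
      have "(\<Sum>z | z \<in> X \<and> pos z = i. t z * l z) =
        (\<Sum>z | z \<in> ?X \<and> pos z = i. t z * l z) + (if i = pos x then c else 0)"
        unfolding fib using y less.prems(1)
        by (subst sum.union_disjoint) (auto simp: t_def l_def algebra_simps)
      then show ?thesis using sm eq by (auto simp: c_def split: if_splits)
    qed
    ultimately show ?thesis by blast
  qed
qed

text \<open>Adding a label to a sum in [-D, 0] gives a sum in [-D, D]; if it is positive, all signs
  are reversed. A sum in this one-sided range, increased by a label in D+1..M, lies in 1..M (see
  \<open>W_bounds\<close>).\<close>

lemma ex_signs_sum_nonpos:
  fixes lab :: "'c \<Rightarrow> int"
  assumes "finite X" "\<And>x. x \<in> X \<Longrightarrow> 0 \<le> lab x \<and> lab x \<le> D" "0 \<le> D"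
  shows "\<exists>s. (\<forall>x. s x \<in> {1, -1}) \<and> -D \<le> (\<Sum>x\<in>X. s x * lab x) \<and> (\<Sum>x\<in>X. s x * lab x) \<le> 0"
  using assms
proof (induction X rule: finite_induct)
  case empty
  then show ?case by (auto intro!: exI[of _ "\<lambda>_. 1"])
next
  case (insert y X)
  then obtain s where s: "\<forall>x. s x \<in> {1, -1}" "-D \<le> (\<Sum>x\<in>X. s x * lab x)" "(\<Sum>x\<in>X. s x * lab x) \<le> 0"
    by auto
  define t where "t = s(y := 1)"
  have t: "(\<Sum>x\<in>insert y X. t x * lab x) = lab y + (\<Sum>x\<in>X. s x * lab x)"
  proof -
    have "(\<Sum>x\<in>X. t x * lab x) = (\<Sum>x\<in>X. s x * lab x)"
      using insert.hyps by (intro sum.cong) (auto simp: t_def)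
    then show ?thesis using insert.hyps by (simp add: t_def)
  qed
  have sg: "\<forall>x. t x \<in> {1, -1}" using s by (auto simp: t_def)
  have ly: "0 \<le> lab y" "lab y \<le> D" using insert.prems by auto
  show ?case
  proof (cases "lab y + (\<Sum>x\<in>X. s x * lab x) \<le> 0")
    case True
    then show ?thesis using sg t s ly by (intro exI[of _ t]) simp
  next
    case False
    have "(\<Sum>x\<in>insert y X. - t x * lab x) = - (lab y + (\<Sum>x\<in>X. s x * lab x))"
      unfolding t[symmetric] by (simp add: sum_negf)
    then show ?thesis using sg False s ly by (intro exI[of _ "\<lambda>x. - t x"]) auto
  qed
qed

subsection \<open>Labels of the spine\<close>

text \<open>
  Spine vertex \<open>i\<close> lies between the spine edges \<open>i - 1\<close> and \<open>i\<close>; \<open>dir j = 1\<close> means that edge \<open>j\<close>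
  points to the higher index. Where the direction does not turn, the two edges contribute exactly
  \<open>1\<close>, because labels are consecutive and decrease along every directed segment. The segments
  occupy successive intervals of labels, which spreads out the contributions at the turns.
\<close>

definition spine_labels :: "nat \<Rightarrow> (nat \<Rightarrow> bool) \<Rightarrow> int \<Rightarrow> (nat \<Rightarrow> int) \<Rightarrow> (nat \<Rightarrow> int) \<Rightarrow> bool" where
  "spine_labels K turn d l dir \<longleftrightarrow>
    bij_betw l {..<K} {1..int K} \<and> dir 0 = d \<and> (\<forall>j. dir j \<in> {1, -1}) \<and>
    (\<forall>i. 0 < i \<longrightarrow> i < K \<longrightarrow> \<not> turn i \<longrightarrow> dir i = dir (i - 1) \<and> dir i * (l (i - 1) - l i) = 1) \<and>
    (\<forall>i. 0 < i \<longrightarrow> i < K \<longrightarrow> turn i \<longrightarrow> dir i = - dir (i - 1)) \<and>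
    (\<forall>i j. 0 < i \<longrightarrow> i < j \<longrightarrow> j < K \<longrightarrow> turn i \<longrightarrow> turn j \<longrightarrow> dir i = dir j \<longrightarrow>
      l (i - 1) + l i + 4 \<le> l (j - 1) + l j) \<and>
    (\<forall>i. 0 < i \<longrightarrow> i < K \<longrightarrow> turn i \<longrightarrow> dir i = d \<longrightarrow> l 0 + 4 \<le> l (i - 1) + l i) \<and>
    (dir (K - 1) = - d \<longrightarrow> l 0 + 1 \<le> l (K - 1)) \<and>
    (dir (K - 1) = - d \<longrightarrow> (\<forall>i. 0 < i \<longrightarrow> i < K \<longrightarrow> turn i \<longrightarrow> dir i = d \<longrightarrow> l 0 + 3 \<le> l (K - 1))) \<and>
    (dir (K - 1) = d \<longrightarrow> (\<forall>i. 0 < i \<longrightarrow> i < K \<longrightarrow> turn i \<longrightarrow> 3 \<le> l (K - 1)))"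

text \<open>
  Induction on the first maximal directed segment; the clauses of \<open>spine_labels\<close> on the first and
  the last edge feed one another and yield the gap between turns of the same sign.
\<close>

lemma ex_spine_labels:
  fixes K :: nat and turn :: "nat \<Rightarrow> bool" and d :: int
  assumes "0 < K" "d \<in> {1, -1}"
  shows "\<exists>l dir. spine_labels K turn d l dir"
  using assms
proof (induction K arbitrary: turn d rule: less_induct)
  case (less K)
  \<comment> \<open>In both cases labels decrease along the arcs, since for \<open>d = -1\<close>
    these run towards index 0.\<close>
  have seg: "bij_betw (\<lambda>j. if d = 1 then int n - int j else int j + 1) {..<n} {1..int n}" for n
    by (rule bij_betwI[where g = "\<lambda>x. if d = 1 then nat (int n - x) else nat (x - 1)"])
      (auto simp: nat_diff_distrib')
  have dd: "d * d = 1" using less.prems by auto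
  show ?case
  proof (cases "\<exists>i. 0 < i \<and> i < K \<and> turn i")
    case False
    show ?thesis
      unfolding spine_labels_def
      by (rule exI[of _ "\<lambda>j. if d = 1 then int K - int j else int j + 1"], rule exI[of _ "\<lambda>_. d"])
        (use False less.prems seg[of K] in \<open>auto simp: of_nat_diff\<close>)
  next
    case True
    define n where "n = (LEAST i. 0 < i \<and> i < K \<and> turn i)"
    have n: "0 < n" "n < K" "turn n" using LeastI_ex[OF True] by (auto simp: n_def)
    have first: "\<not> turn i" if "0 < i" "i < n" for i
      using not_less_Least[of i "\<lambda>i. 0 < i \<and> i < K \<and> turn i"] that n by (auto simp: n_def)
    have "K - n < K" "0 < K - n" "- d \<in> {1, -1}" using n less.prems by auto
    from less.IH[OF this, of "\<lambda>i. turn (i + n)"] obtain l dir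
      where sl: "spine_labels (K - n) (\<lambda>i. turn (i + n)) (- d) l dir"
      by blast
    note sl = sl[unfolded spine_labels_def]
    from sl have bij: "bij_betw l {..<K-n} {1..int (K-n)}" and d0: "dir 0 = - d" and d1: "\<forall>j. dir j \<in> {1, -1}"
      by simp_all
    from sl have pass: "dir i = dir (i - 1) \<and> dir i * (l (i - 1) - l i) = 1"
      if "0 < i" "i < K - n" "\<not> turn (i + n)" for i
      using that by blast
    from sl have trn: "dir i = - dir (i - 1)" if "0 < i" "i < K - n" "turn (i + n)" for i
      using that by blast
    from sl have gap: "l (i - 1) + l i + 4 \<le> l (j - 1) + l j"
      if "0 < i" "i < j" "j < K - n" "turn (i + n)" "turn (j + n)" "dir i = dir j" for i j
      using that by blast
    from sl have near: "l 0 + 4 \<le> l (i - 1) + l i"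
      if "0 < i" "i < K - n" "turn (i + n)" "dir i = - d" for i
      using that by blast
    from sl have far: "l 0 + 1 \<le> l (K - n - 1)" if "dir (K - n - 1) = d" using that by simp
    from sl have far': "3 \<le> l (K - n - 1)"
      if "dir (K - n - 1) = - d" "0 < i" "i < K - n" "turn (i + n)" for i using that by blast
    \<comment> \<open>The first segment takes the labels 1..n. The remainder starts with edge
      \<open>n\<close> in direction \<open>- d\<close>, and its labels are shifted up by
      \<open>n\<close>.\<close>
    define l' where "l' j = (if j < n then if d = 1 then int n - int j else int j + 1 else int n + l (j - n))" for j
    define dir' where "dir' j = (if j < n then d else dir (j - n))" for j
    have lo: "1 \<le> l j" "l j \<le> int (K - n)" if "j < K - n" for j
      using bij_betwE[OF bij] that by auto
    have lo2: "3 \<le> l i + l j" if "i < K - n" "j < K - n" "i \<noteq> j" for i j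
    proof -
      have "l i \<noteq> l j" using bij that by (auto simp: bij_betw_def inj_on_def)
      then show ?thesis using lo[OF that(1)] lo[OF that(2)] by linarith
    qed
    have l'lo: "1 \<le> l' j" "l' j \<le> int n" if "j < n" for j using that by (auto simp: l'_def)
    have bij': "bij_betw l' {..<K} {1..int K}"
    proof -
      have "bij_betw l' ({..<n} \<union> {n..<K}) ({1..int n} \<union> {int n + 1..int K})"
      proof (rule bij_betw_combine)
        show "bij_betw l' {..<n} {1..int n}"
          using seg[of n] by (rule bij_betw_cong[THEN iffD1, rotated]) (auto simp: l'_def)
        have "bij_betw (\<lambda>j. j - n) {n..<K} {..<K-n}"
          by (rule bij_betwI[where g = "\<lambda>j. j + n"]) auto
        moreover have "bij_betw (\<lambda>x. int n + x) {1..int (K-n)} {int n + 1..int K}"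
          using n by (intro bij_betwI[where g = "\<lambda>x. x - int n"]) auto
        ultimately have "bij_betw ((\<lambda>x. int n + x) \<circ> (l \<circ> (\<lambda>j. j - n))) {n..<K} {int n + 1..int K}"
          using bij by (blast intro: bij_betw_trans)
        then show "bij_betw l' {n..<K} {int n + 1..int K}"
          by (rule bij_betw_cong[THEN iffD1, rotated]) (auto simp: l'_def)
      qed auto
      moreover have "{..<n} \<union> {n..<K} = {..<K}" "{1..int n} \<union> {int n + 1..int K} = {1..int K}"
        using n by auto
      ultimately show ?thesis by simp
    qed
    have shift: "dir' i = dir (i - n)" "l' i = int n + l (i - n)" "dir' (i - 1) = dir (i - n - 1)"
      "l' (i - 1) = int n + l (i - n - 1)" if "n < i" for i
      using that by (auto simp: dir'_def l'_def)
    have at_n: "dir' n = - d" "l' n = int n + l 0" "dir' (n - 1) = d"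
      using n d0 by (auto simp: dir'_def l'_def)
    have last: "dir' (K - 1) = dir (K - n - 1)" "l' (K - 1) = int n + l (K - n - 1)"
      using n by (auto simp: dir'_def l'_def)
    have pass': "dir' i = dir' (i - 1) \<and> dir' i * (l' (i - 1) - l' i) = 1"
      if "0 < i" "i < K" "\<not> turn i" for i
    proof (cases "i < n")
      case True
      then show ?thesis using that less.prems by (auto simp: dir'_def l'_def of_nat_diff)
    next
      case False
      then have "n < i" using that n by (cases "i = n") auto
      then have "i - n < K - n" using that by simp
      then show ?thesis using pass[of "i - n"] that shift[of i] \<open>n < i\<close> by auto
    qed
    have trn': "dir' i = - dir' (i - 1)" if "0 < i" "i < K" "turn i" for i
    proof -
      have "i = n \<or> n < i" using first[of i] that by (metis linorder_neqE_nat)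
      then show ?thesis
      proof
        assume "i = n"
        then show ?thesis using at_n by simp
      next
        assume "n < i"
        then show ?thesis using trn[of "i - n"] that shift[of i] by auto
      qed
    qed
    \<comment> \<open>For the first turn, the gap comes from the clause on \<open>l 0\<close> in the
      remainder, because \<open>l' (n - 1)\<close> is at most \<open>n\<close>.\<close>
    have gap': "l' (i - 1) + l' i + 4 \<le> l' (j - 1) + l' j"
      if "0 < i" "i < j" "j < K" "turn i" "turn j" "dir' i = dir' j" for i j
    proof -
      have "i = n \<or> n < i" using first[of i] that by (metis linorder_neqE_nat)
      then show ?thesis
      proof
        assume 1: "i = n"
        moreover have "j - n < K - n" using that n by simp
        ultimately have "l 0 + 4 \<le> l (j - n - 1) + l (j - n)"
          using near[of "j - n"] that shift[of j] at_n by auto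
        then show ?thesis using 1 shift[of j] at_n l'lo[of "n - 1"] n that by auto
      next
        assume "n < i"
        moreover have "i - n < j - n" "j - n < K - n" using that \<open>n < i\<close> by simp_all
        ultimately show ?thesis using gap[of "i - n" "j - n"] that shift[of i] shift[of j] by auto
      qed
    qed
    have later: "n < i" if "0 < i" "i < K" "turn i" "dir' i = d" for i
    proof -
      have "i \<noteq> n" using that at_n less.prems by auto
      then show ?thesis using first[of i] that by (metis linorder_neqE_nat)
    qed
    \<comment> \<open>Both edges lie beyond the first segment: two distinct labels above
      \<open>n\<close> add up to at least 2n + 3, while \<open>l' 0\<close> is at most
      \<open>n\<close> and \<open>n\<close> is at least 1.\<close>
    have near': "l' 0 + 4 \<le> l' (i - 1) + l' i" if "0 < i" "i < K" "turn i" "dir' i = d" for i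
    proof -
      have "3 \<le> l (i - n - 1) + l (i - n)" using later[OF that] that by (intro lo2) auto
      then show ?thesis using shift[OF later[OF that]] l'lo[of 0] n by auto
    qed
    have far1: "l' 0 + 1 \<le> l' (K - 1)"
    proof -
      have "K - n - 1 < K - n" using n by simp
      then show ?thesis using last l'lo[of 0] lo[of "K - n - 1"] n by linarith
    qed
    have far2: "l' 0 + 3 \<le> l' (K - 1)" if "dir' (K - 1) = - d" "0 < i" "i < K" "turn i" "dir' i = d" for i
    proof -
      have "n < i" using later that by blast
      then have "3 \<le> l (K - n - 1)" using that last by (intro far'[of "i - n"]) auto
      then show ?thesis using last l'lo[of 0] n by auto
    qed
    \<comment> \<open>The remainder starts in direction \<open>- d\<close> and ends in direction
      \<open>d\<close>, so its last label is at least 2; the shift adds at least 1.\<close>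
    have far3: "3 \<le> l' (K - 1)" if "dir' (K - 1) = d"
      using far that last n lo[of 0] by auto
    have "spine_labels K turn d l' dir'"
      unfolding spine_labels_def
    proof (intro conjI allI impI)
      show "dir' 0 = d" using n by (simp add: dir'_def)
      show "dir' j \<in> {1, -1}" for j using d1 less.prems by (simp add: dir'_def)
    qed (use bij' pass' trn' gap' near' far1 far2 far3 in blast)+
    then show ?thesis by blast
  qed
qed

subsection \<open>The structure of a lobster\<close>

text \<open>
  The spine is lengthened at both ends by a vertex that has only leaves besides its spine
  neighbour, and its vertices are \<open>0..K\<close>. \<open>A\<close> collects the leaves attached to the spine, \<open>W\<close> the
  remaining neighbours of the spine and \<open>F\<close> the leaves attached to \<open>W\<close>. A vertex outside the spine
  also stands for the edge to its parent, which is spine vertex \<open>pos v\<close> on \<open>A\<close> and \<open>W\<close> and \<open>own v\<close>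
  on \<open>F\<close>.
\<close>

locale lobster_skeleton =
  fixes K :: nat and A W F :: "'a set" and pos :: "'a \<Rightarrow> nat" and own :: "'a \<Rightarrow> 'a"
  assumes fin: "finite A" "finite W" "finite F"
    and disj: "A \<inter> W = {}" "A \<inter> F = {}" "W \<inter> F = {}"
    and K_ge_2: "2 \<le> K"
    and pos_A: "a \<in> A \<Longrightarrow> pos a \<le> K"
    and pos_W: "w \<in> W \<Longrightarrow> 0 < pos w \<and> pos w < K"
    and own_F: "f \<in> F \<Longrightarrow> own f \<in> W"
    and W_has_leaf: "w \<in> W \<Longrightarrow> \<exists>f. f \<in> F \<and> own f = w"
    and ends: "\<exists>a. a \<in> A \<and> pos a = 0" "\<exists>a. a \<in> A \<and> pos a = K"
begin

definition "A_at i = {a \<in> A. pos a = i}"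
definition "W_at i = {w \<in> W. pos w = i}"
text \<open>The classes are named after the kinds of children left over by the pairing. The
  orientation of the spine turns exactly at \<open>I_none\<close>.\<close>

definition "I_none = {i. 0 < i \<and> i < K \<and> even (card (A_at i)) \<and> even (card (W_at i))}"
definition "I_A = {i. 0 < i \<and> i < K \<and> odd (card (A_at i)) \<and> even (card (W_at i))}"
definition "I_W = {i. 0 < i \<and> i < K \<and> even (card (A_at i)) \<and> odd (card (W_at i))}"
definition "I_both = {i. 0 < i \<and> i < K \<and> odd (card (A_at i)) \<and> odd (card (W_at i))}"
text \<open>
  Children of a spine vertex are cancelled in pairs inside \<open>A\<close> and inside \<open>W\<close>; \<open>sA i\<close> and \<open>sW i\<close>
  are the children left over. At the ends \<open>sA i\<close> is always set apart, so that a second one, \<open>tA i\<close>,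
  remains when the number of children is even. The leaf \<open>fW w\<close> of \<open>w\<close> is labelled last.
\<close>

definition "I_end = {i \<in> {0, K}. even (card (A_at i))}"
definition "sA i = (SOME a. a \<in> A \<and> pos a = i)"
definition "tA i = (SOME a. a \<in> A \<and> pos a = i \<and> a \<noteq> sA i)"
definition "sW i = (SOME w. w \<in> W \<and> pos w = i)"
definition "fW w = (SOME f. f \<in> F \<and> own f = w)"
definition "PA = A - sA ` ({0, K} \<union> I_A \<union> I_both) - tA ` I_end"
definition "PW = W - sW ` (I_W \<union> I_both)"
definition "R = F - fW ` W"
definition "PA_at i = {a \<in> PA. pos a = i}"
definition "PW_at i = {w \<in> PW. pos w = i}"
definition "R_at w = {f \<in> R. own f = w}"

section \<open>Classes of spine vertices and their chosen children\<close>

lemmas I_defs = I_none_def I_A_def I_W_def I_both_def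

lemma I_disjoint:
  "I_none \<inter> I_A = {}" "I_none \<inter> I_W = {}" "I_none \<inter> I_both = {}"
  "I_A \<inter> I_W = {}" "I_A \<inter> I_both = {}" "I_W \<inter> I_both = {}"
  by (auto simp: I_defs)

lemma I_interior: "i \<in> I_none \<union> I_A \<union> I_W \<union> I_both \<Longrightarrow> 0 < i \<and> i < K"
  by (auto simp: I_defs)

lemma I_cases:
  assumes "i \<le> K"
  obtains "i = 0" | "i = K" | "i \<in> I_none" | "i \<in> I_A" | "i \<in> I_W" | "i \<in> I_both"
  using assms by (cases "i = 0"; cases "i = K"; auto simp: I_defs)

lemma finite_I: "finite I_none" "finite I_A" "finite I_W" "finite I_both" "finite I_end"
  by (auto simp: I_defs I_end_def)

lemma I_end_subset: "I_end \<subseteq> {0, K}"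
  by (auto simp: I_end_def)

lemma finite_at: "finite (A_at i)" "finite (W_at i)" "finite PA" "finite PW" "finite R"
    "finite (PA_at i)" "finite (PW_at i)" "finite (R_at w)"
  using fin by (auto simp: A_at_def W_at_def PA_def PW_def R_def PA_at_def PW_at_def R_at_def)

lemma sA: assumes "i \<in> {0, K} \<union> I_A \<union> I_both" shows "sA i \<in> A" "pos (sA i) = i"
proof -
  have "A_at i \<noteq> {}" if "odd (card (A_at i))" using that by auto
  then have "\<exists>a. a \<in> A \<and> pos a = i"
    using assms ends by (auto simp: I_A_def I_both_def A_at_def)
  from someI_ex[OF this] show "sA i \<in> A" "pos (sA i) = i" by (simp_all add: sA_def)
qed

lemma tA: assumes "i \<in> I_end" shows "tA i \<in> A" "pos (tA i) = i" "tA i \<noteq> sA i"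
proof -
  have "sA i \<in> A_at i" using assms sA[of i] by (auto simp: I_end_def A_at_def)
  moreover have "A_at i \<noteq> {sA i}" using assms by (auto simp: I_end_def)
  ultimately have "\<exists>a. a \<in> A \<and> pos a = i \<and> a \<noteq> sA i" by (auto simp: A_at_def)
  from someI_ex[OF this] show "tA i \<in> A" "pos (tA i) = i" "tA i \<noteq> sA i" by (simp_all add: tA_def)
qed

lemma sW: assumes "i \<in> I_W \<union> I_both" shows "sW i \<in> W" "pos (sW i) = i"
proof -
  have "W_at i \<noteq> {}" using assms by (auto simp: I_W_def I_both_def)
  then have "\<exists>w. w \<in> W \<and> pos w = i" by (auto simp: W_at_def)
  from someI_ex[OF this] show "sW i \<in> W" "pos (sW i) = i" by (simp_all add: sW_def)
qed

lemma fW: assumes "w \<in> W" shows "fW w \<in> F" "own (fW w) = w"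
  using someI_ex[OF W_has_leaf[OF assms]] by (simp_all add: fW_def)

lemma inj_sA: "inj_on sA ({0, K} \<union> I_A \<union> I_both)"
  using sA(2) by (metis inj_onI)

lemma inj_sW: "inj_on sW (I_W \<union> I_both)" using sW(2) by (metis inj_onI)

lemma inj_fW: "inj_on fW W" using fW(2) by (metis inj_onI)

lemma sA_ne_tA: "i \<in> {0, K} \<union> I_A \<union> I_both \<Longrightarrow> j \<in> I_end \<Longrightarrow> sA i \<noteq> tA j"
  using sA(2) tA(2,3) by metis

section \<open>Children of a spine vertex, split into pairs and left-overs\<close>

lemma A_at_eq: "A_at i = PA_at i \<union> (if i \<in> {0, K} \<union> I_A \<union> I_both then {sA i} else {}) \<union>
    (if i \<in> I_end then {tA i} else {})"
(is "_ = ?B")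
proof
  show "A_at i \<subseteq> ?B"
  proof
    fix a assume a: "a \<in> A_at i"
    then have i: "pos a = i" "a \<in> A" by (auto simp: A_at_def)
    consider "a \<in> PA" | "a \<in> sA ` ({0, K} \<union> I_A \<union> I_both)" | "a \<in> tA ` I_end"
      using i by (auto simp: PA_def)
    then show "a \<in> ?B"
    proof cases
      case 1
      then show ?thesis using i by (simp add: PA_at_def)
    next
      case 2
      then obtain j where j: "j \<in> {0, K} \<union> I_A \<union> I_both" "a = sA j" by blast
      then have "j = i" using sA(2)[OF j(1)] i by simp
      then show ?thesis using j by simp
    next
      case 3
      then obtain j where j: "j \<in> I_end" "a = tA j" by blast
      then have "j = i" using tA(2)[OF j(1)] i by simp
      then show ?thesis using j by simp
    qed
  qed
  have "sA i \<in> A_at i" if "i \<in> {0, K} \<union> I_A \<union> I_both" using sA[OF that] by (simp add: A_at_def)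
  moreover have "tA i \<in> A_at i" if "i \<in> I_end" using tA[OF that] by (simp add: A_at_def)
  ultimately show "?B \<subseteq> A_at i"
    by (simp add: PA_at_def A_at_def PA_def subset_iff)
qed

lemma sum_A_at: "sum g (A_at i) = sum g (PA_at i) +
    (if i \<in> {0, K} \<union> I_A \<union> I_both then g (sA i) else 0) + (if i \<in> I_end then g (tA i) else (0::int))"
proof -
  have "sA i \<notin> PA_at i" if "i \<in> {0, K} \<union> I_A \<union> I_both" using that by (auto simp: PA_at_def PA_def)
  moreover have "tA i \<notin> PA_at i" if "i \<in> I_end" using that by (auto simp: PA_at_def PA_def)
  ultimately show ?thesis
    unfolding A_at_eq using tA(3)[of i] I_end_subset finite_at(6)[of i] by (auto simp: Un_commute)
qed

lemma W_at_eq: "W_at i = PW_at i \<union> (if i \<in> I_W \<union> I_both then {sW i} else {})"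
  using sW unfolding W_at_def PW_at_def PW_def by (auto split: if_splits)

lemma sum_W_at: "sum g (W_at i) = sum g (PW_at i) + (if i \<in> I_W \<union> I_both then g (sW i) else (0::int))"
proof -
  have "sW i \<notin> PW_at i" if "i \<in> I_W \<union> I_both" using that by (auto simp: PW_at_def PW_def)
  then show ?thesis unfolding W_at_eq using finite_at(7)[of i] by auto
qed

lemma sum_own: "w \<in> W \<Longrightarrow> (\<Sum>f | f \<in> F \<and> own f = w. g f) = g (fW w) + (sum g (R_at w) :: int)"
proof -
  assume w: "w \<in> W"
  have "{f. f \<in> F \<and> own f = w} = insert (fW w) (R_at w)"
    using fW[OF w] fW by (auto simp: R_at_def R_def)
  moreover have "fW w \<notin> R_at w" using w by (auto simp: R_at_def R_def)
  ultimately show ?thesis using finite_at by simp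
qed

text \<open>Set apart are one leaf where their number is odd, two at an end where it is even, and
  none elsewhere; the rest is even each time, as \<open>ex_paired_labels\<close> requires.\<close>

lemma even_PA_at: "even (card (PA_at i))"
proof (cases "i \<le> K")
  case True
  have "int (card (A_at i)) = int (card (PA_at i)) +
      (if i \<in> {0, K} \<union> I_A \<union> I_both then 1 else 0) + (if i \<in> I_end then 1 else 0)"
    using sum_A_at[of "\<lambda>_. 1" i] by simp
  moreover have "(i \<in> {0, K} \<union> I_A \<union> I_both \<and> i \<notin> I_end) = odd (card (A_at i))"
    using True by (auto simp: I_defs I_end_def)
  moreover have "i \<in> I_end \<Longrightarrow> i \<in> {0, K}" by (auto simp: I_end_def)
  moreover have "even p" if "int c = int p + (if S then 1 else 0) + (if E then 1 else 0)"
    "(S \<and> \<not> E) = odd c" "E \<Longrightarrow> S" for c p :: nat and S E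
    using that by (cases S; cases E; simp; presburger)
  ultimately show ?thesis by blast
next
  case False
  then have "PA_at i = {}" using pos_A by (force simp: PA_at_def PA_def)
  then show ?thesis by simp
qed

lemma even_PW_at: "even (card (PW_at i))"
proof (cases "0 < i \<and> i < K")
  case True
  have "int (card (W_at i)) = int (card (PW_at i)) + (if i \<in> I_W \<union> I_both then 1 else 0)"
    using sum_W_at[of "\<lambda>_. 1" i] by simp
  moreover have "(i \<in> I_W \<union> I_both) = odd (card (W_at i))"
    using True by (auto simp: I_defs)
  moreover have "even p" if "int c = int p + (if S then 1 else 0)" "S = odd c" for c p :: nat and S
    using that by (cases S; simp; presburger)
  ultimately show ?thesis by blast
next
  case False
  then have "PW_at i = {}" using pos_W by (force simp: PW_at_def PW_def)
  then show ?thesis by simp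
qed

end

subsection \<open>Values of a labelling\<close>

context lobster_skeleton
begin

text \<open>
  Upper ends of the intervals of labels, from small to large: the leaves in \<open>R\<close> and the \<open>tA i\<close>; the
  \<open>fW w\<close>; the \<open>sA i\<close> with \<open>i \<in> I_both\<close>; the two labels of \<open>sA 0\<close> and \<open>sA K\<close>; \<open>PA\<close>; the other \<open>sA i\<close>;
  then inside \<open>W\<close> the \<open>sW i\<close> with \<open>i \<in> I_W\<close>, \<open>PW\<close>, and the \<open>sW i\<close> with \<open>i \<in> I_both\<close>. Labels above
  \<open>N\<close> go to the spine.
\<close>

definition "D = int (card (R \<union> tA ` I_end))"
definition "M = D + int (card W)"
definition "q = int (card I_both)"
definition "T = M + q + 2 + int (card PA)"
definition "B = T + int (card I_A)"
definition "H = B + int (card I_W)"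
definition "N = B + int (card W)"

definition "pair_sum lab s i = (\<Sum>a\<in>PA_at i. s a * lab a) + (\<Sum>w\<in>PW_at i. s w * lab w :: int)"
text \<open>The factor \<open>- s w\<close> measures the sum relative to the sign of the spine edge,
  so that it adds to \<open>lab w\<close> and \<open>lab (fW w)\<close> in the absolute value at
  \<open>w\<close> (see \<open>nval_W\<close>).\<close>

definition "rest_sum lab s w = - s w * (\<Sum>f\<in>R_at w. s f * lab f :: int)"
text \<open>
  The sign of the contribution of the pairs at \<open>i\<close>, if it is not \<open>0\<close>. It never decreases the absolute
  value at a turn, and it keeps the values at \<open>I_A\<close> below those at \<open>I_W\<close>.
\<close>

definition "pair_sign dir i = (if i = 0 then if 0 \<in> I_end then 1 else - 1
   else if i = K then dir (K - 1) else if i \<in> I_none then dir (i - 1)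
   else if i \<in> I_W then 1 else - 1 :: int)"

text \<open>The tree is rooted at spine vertex \<open>K\<close>, and sign 1 directs an edge to the
  parent. Spine edge \<open>j\<close> belongs to vertex \<open>j\<close>, with parent
  \<open>j + 1\<close>, label \<open>N + lam j\<close> and sign \<open>dir j\<close>.\<close>

definition "spine_val lab s lam dir i =
  (if i = 0 then 0 else dir (i - 1) * (N + lam (i - 1))) - (if i = K then 0 else dir i * (N + lam i)) +
  (\<Sum>a\<in>A_at i. s a * lab a) + (\<Sum>w\<in>W_at i. s w * lab w :: int)"
definition "node_val lab s v = - s v * lab v + (\<Sum>f | f \<in> F \<and> own f = v. s f * lab f :: int)"

section \<open>Order and disjointness of the label intervals\<close>

lemma card_I_W_both: "int (card I_W) + q \<le> int (card W)"
proof -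
  have "card (sW ` (I_W \<union> I_both)) \<le> card W" using sW fin by (intro card_mono) auto
  moreover have "card (sW ` (I_W \<union> I_both)) = card I_W + card I_both"
    using inj_sW finite_I I_disjoint by (simp add: card_image card_Un_disjoint)
  ultimately show ?thesis by (simp add: q_def)
qed

lemma zone_order: "0 \<le> D" "D \<le> M" "M \<le> M + q" "M + q + 2 \<le> T" "T \<le> B" "B \<le> H" "H \<le> N - q" "N - q \<le> N"
  using card_I_W_both by (simp_all add: D_def M_def q_def T_def B_def H_def N_def)

text \<open>Keeps the values at \<open>I_W\<close>, which are at most H + 2, strictly below those at
  \<open>I_both\<close>, which are at least M + N - q + 2.\<close>

lemma M_ge_1: "w \<in> W \<Longrightarrow> 1 \<le> M"
proof -
  assume "w \<in> W"
  then have "0 < card W" using fin by (auto simp: card_gt_0_iff)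
  then show ?thesis using zone_order by (simp add: M_def)
qed

lemma A_F_eq: "A \<union> F = (R \<union> tA ` I_end) \<union> fW ` W \<union> sA ` I_both \<union> {sA 0, sA K} \<union> PA \<union> sA ` I_A"
proof -
  have A: "A = PA \<union> sA ` ({0, K} \<union> I_A \<union> I_both) \<union> tA ` I_end"
    unfolding PA_def using sA(1) tA(1) by blast
  have F: "F = R \<union> fW ` W" unfolding R_def using fW(1) by blast
  have "A \<union> F = (PA \<union> sA ` ({0, K} \<union> I_A \<union> I_both) \<union> tA ` I_end) \<union> (R \<union> fW ` W)"
    by (rule arg_cong2[OF A F])
  also have "\<dots> = (R \<union> tA ` I_end) \<union> fW ` W \<union> sA ` I_both \<union> {sA 0, sA K} \<union> PA \<union> sA ` I_A"
    by (simp only: image_Un image_insert image_empty Un_ac)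
  finally show ?thesis .
qed

lemma W_eq: "W = sW ` I_W \<union> PW \<union> sW ` I_both"
  using sW unfolding PW_def by auto

lemma zones_disjoint:
  "(R \<union> tA ` I_end) \<inter> fW ` W = {}"
  "(R \<union> tA ` I_end \<union> fW ` W) \<inter> sA ` I_both = {}"
  "(R \<union> tA ` I_end \<union> fW ` W \<union> sA ` I_both) \<inter> {sA 0, sA K} = {}"
  "(R \<union> tA ` I_end \<union> fW ` W \<union> sA ` I_both \<union> {sA 0, sA K}) \<inter> PA = {}"
  "(R \<union> tA ` I_end \<union> fW ` W \<union> sA ` I_both \<union> {sA 0, sA K} \<union> PA) \<inter> sA ` I_A = {}"
  "sW ` I_W \<inter> PW = {}" "(sW ` I_W \<union> PW) \<inter> sW ` I_both = {}"
proof -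
  let ?S = "{0, K} \<union> I_A \<union> I_both"
  have AF: "A \<inter> F = {}" by (rule disj)
  have FR: "fW ` W \<subseteq> F - R" "R \<subseteq> F" using fW by (auto simp: R_def)
  have tA': "tA ` I_end \<subseteq> A" and PA': "PA \<subseteq> A" "PA \<inter> tA ` I_end = {}" "PA \<inter> sA ` ?S = {}"
    using tA by (auto simp: PA_def)
  have sA': "sA ` ?S \<subseteq> A" "sA ` ?S \<inter> tA ` I_end = {}"
    using sA(1) sA_ne_tA by blast+
  have ends: "I_both \<inter> {0, K} = {}" "I_A \<inter> {0, K} = {}" by (auto simp: I_defs)
  have sd: "sA ` X \<inter> sA ` Y = {}" if "X \<subseteq> ?S" "Y \<subseteq> ?S" "X \<inter> Y = {}" for X Y
    using inj_on_image_Int[OF inj_sA that(1,2)] that(3) by simp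
  have im: "{sA 0, sA K} = sA ` {0, K}" by simp
  have sub: "R \<inter> sA ` X = {}" "fW ` W \<inter> sA ` X = {}" "tA ` I_end \<inter> sA ` X = {}" "PA \<inter> sA ` X = {}"
      "sA ` X \<inter> PA = {}"
    if "X \<subseteq> ?S" for X
  proof -
    have X: "sA ` X \<subseteq> sA ` ?S" using that by blast
    show "R \<inter> sA ` X = {}" "fW ` W \<inter> sA ` X = {}" using X sA'(1) AF FR by blast+
    show "tA ` I_end \<inter> sA ` X = {}" using X sA'(2) by blast
    show "PA \<inter> sA ` X = {}" "sA ` X \<inter> PA = {}" using X PA'(3) by blast+
  qed
  have S: "{0, K} \<subseteq> ?S" "I_A \<subseteq> ?S" "I_both \<subseteq> ?S" by blast+
  have PR: "R \<inter> PA = {}" "fW ` W \<inter> PA = {}" "tA ` I_end \<inter> PA = {}" using AF FR PA' by blast+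
  have Un: "(X \<union> Y) \<inter> Z = {}" if "X \<inter> Z = {}" "Y \<inter> Z = {}" for X Y Z :: "'a set" using that by blast
  show "(R \<union> tA ` I_end) \<inter> fW ` W = {}" using AF FR tA' by blast
  show "(R \<union> tA ` I_end \<union> fW ` W) \<inter> sA ` I_both = {}" by (intro Un sub[OF S(3)])
  show "(R \<union> tA ` I_end \<union> fW ` W \<union> sA ` I_both) \<inter> {sA 0, sA K} = {}"
    unfolding im by (intro Un sub[OF S(1)] sd[OF S(3,1) ends(1)])
  show "(R \<union> tA ` I_end \<union> fW ` W \<union> sA ` I_both \<union> {sA 0, sA K}) \<inter> PA = {}"
    unfolding im by (intro Un PR sub(5)[OF S(1)] sub(5)[OF S(3)])
  show "(R \<union> tA ` I_end \<union> fW ` W \<union> sA ` I_both \<union> {sA 0, sA K} \<union> PA) \<inter> sA ` I_A = {}"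
    unfolding im by (intro Un sub[OF S(2)] sd[OF S(1,2)] sd[OF S(3,2)]) (use ends I_disjoint(5) in blast)+
  show "sW ` I_W \<inter> PW = {}" by (auto simp: PW_def)
  have "sW ` I_W \<inter> sW ` I_both = {}"
    using inj_sW I_disjoint(6) by (subst inj_on_image_Int[OF inj_sW, symmetric]) auto
  then show "(sW ` I_W \<union> PW) \<inter> sW ` I_both = {}" by (auto simp: PW_def)
qed

lemma sA_0_K: "sA 0 \<noteq> sA K"
  using inj_onD[OF inj_sA, of 0 K] K_ge_2 by auto

end

text \<open>\<open>inj_W\<close> compares equal signs only, since the value at \<open>w\<close> has
  the sign of \<open>- s w\<close>. When both signs occur in \<open>W\<close>,
  \<open>large_fW\<close> denies the label D + 1 to the negative ones; this lifts their values just
  above those at \<open>I_W\<close>. \<open>lab_ends\<close> fixes the two end labels only as a set,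
  so that they may be exchanged.\<close>

locale lobster_labelling = lobster_skeleton +
  fixes lab s :: "'a \<Rightarrow> int" and lam dir :: "nat \<Rightarrow> int"
  assumes spine: "spine_labels K (\<lambda>i. i \<in> I_none) 1 lam dir"
    and sgn: "v \<in> A \<union> W \<union> F \<Longrightarrow> s v \<in> {1, - 1}"
    and lab_R: "bij_betw lab (R \<union> tA ` I_end) {1..D}"
    and lab_tA_0: "0 \<in> I_end \<Longrightarrow> lab (tA 0) = 1"
    and lab_fW: "bij_betw lab (fW ` W) {D+1..M}"
    and lab_both: "bij_betw lab (sA ` I_both) {M+1..M+q}"
    and lab_ends: "{lab (sA 0), lab (sA K)} = {M+q+1, M+q+2}"
    and lab_PA: "bij_betw lab PA {M+q+2+1..T}"
    and lab_A: "bij_betw lab (sA ` I_A) {T+1..B}"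
    and lab_W: "bij_betw lab (sW ` I_W) {B+1..H}"
    and lab_PW: "bij_betw lab PW {H+1..N-q}"
    and lab_both_W: "bij_betw lab (sW ` I_both) {N-q+1..N}"
    and s_sA: "i \<in> I_A \<union> I_both \<Longrightarrow> s (sA i) = 1"
    and s_sW: "i \<in> I_W \<union> I_both \<Longrightarrow> s (sW i) = 1"
    and s_end: "s (sA 0) = - 1" "0 \<in> I_end \<Longrightarrow> s (tA 0) = - 1"
      "s (sA K) = dir (K - 1)" "K \<in> I_end \<Longrightarrow> s (tA K) = dir (K - 1)"
    and s_fW: "w \<in> W \<Longrightarrow> s (fW w) = - s w"
    and pairs: "i \<le> K \<Longrightarrow> pair_sum lab s i \<in> {0, pair_sign dir i}"
    and rests: "w \<in> W \<Longrightarrow> - D \<le> rest_sum lab s w \<and> rest_sum lab s w \<le> 0"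
    and large_fW: "w \<in> W \<Longrightarrow> s w = - 1 \<Longrightarrow> w' \<in> W \<Longrightarrow> s w' = 1 \<Longrightarrow> D + 2 \<le> lab (fW w)"
    and inj_W: "w \<in> W \<Longrightarrow> w' \<in> W \<Longrightarrow> s w = s w' \<Longrightarrow>
      lab w + rest_sum lab s w + lab (fW w) = lab w' + rest_sum lab s w' + lab (fW w') \<Longrightarrow> w = w'"
    and inj_I_A: "inj_on (\<lambda>i. pair_sum lab s i + lab (sA i)) I_A"
    and inj_I_W: "inj_on (\<lambda>i. pair_sum lab s i + lab (sW i)) I_W"
    and inj_I_both: "inj_on (\<lambda>i. pair_sum lab s i + lab (sA i) + lab (sW i)) I_both"
begin

abbreviation "sval \<equiv> spine_val lab s lam dir"
abbreviation "nval \<equiv> node_val lab s"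

section \<open>Ranges of the labels and values at the spine\<close>

lemma lab_A_F: "bij_betw lab (A \<union> F) {1..B}"
proof -
  note z = zone_order and d = zones_disjoint
  have E: "bij_betw lab {sA 0, sA K} {M+q+1, M+q+2}"
    using lab_ends sA_0_K by (auto simp: bij_betw_def inj_on_def doubleton_eq_iff)
  have "bij_betw lab (R \<union> tA ` I_end \<union> fW ` W) ({1..D} \<union> {D+1..M})"
    by (rule bij_betw_combine[OF lab_R lab_fW]) auto
  also have "{1..D} \<union> {D+1..M} = {1..M}" using z by auto
  finally have 1: "bij_betw lab (R \<union> tA ` I_end \<union> fW ` W) {1..M}" .
  have "bij_betw lab (R \<union> tA ` I_end \<union> fW ` W \<union> sA ` I_both) ({1..M} \<union> {M+1..M+q})"
    by (rule bij_betw_combine[OF 1 lab_both]) auto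
  also have "{1..M} \<union> {M+1..M+q} = {1..M+q}" using z by auto
  finally have 2: "bij_betw lab (R \<union> tA ` I_end \<union> fW ` W \<union> sA ` I_both) {1..M+q}" .
  have "bij_betw lab (R \<union> tA ` I_end \<union> fW ` W \<union> sA ` I_both \<union> {sA 0, sA K}) ({1..M+q} \<union> {M+q+1, M+q+2})"
    by (rule bij_betw_combine[OF 2 E]) auto
  also have "{1..M+q} \<union> {M+q+1, M+q+2} = {1..M+q+2}" using z by auto
  finally have 3: "bij_betw lab (R \<union> tA ` I_end \<union> fW ` W \<union> sA ` I_both \<union> {sA 0, sA K}) {1..M+q+2}" .
  have "bij_betw lab (R \<union> tA ` I_end \<union> fW ` W \<union> sA ` I_both \<union> {sA 0, sA K} \<union> PA) ({1..M+q+2} \<union> {M+q+2+1..T})"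
    by (rule bij_betw_combine[OF 3 lab_PA]) auto
  also have "{1..M+q+2} \<union> {M+q+2+1..T} = {1..T}" using z by auto
  finally have 4: "bij_betw lab (R \<union> tA ` I_end \<union> fW ` W \<union> sA ` I_both \<union> {sA 0, sA K} \<union> PA) {1..T}" .
  have "bij_betw lab (A \<union> F) ({1..T} \<union> {T+1..B})"
    unfolding A_F_eq by (rule bij_betw_combine[OF 4 lab_A]) auto
  also have "{1..T} \<union> {T+1..B} = {1..B}" using z by auto
  finally show ?thesis .
qed

lemma lab_W_all: "bij_betw lab W {B+1..N}"
proof -
  note z = zone_order
  have "bij_betw lab (sW ` I_W \<union> PW) ({B+1..H} \<union> {H+1..N-q})"
    by (rule bij_betw_combine[OF lab_W lab_PW]) auto
  also have "{B+1..H} \<union> {H+1..N-q} = {B+1..N-q}" using z by auto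
  finally have 1: "bij_betw lab (sW ` I_W \<union> PW) {B+1..N-q}" .
  have "bij_betw lab (sW ` I_W \<union> PW \<union> sW ` I_both) ({B+1..N-q} \<union> {N-q+1..N})"
    by (rule bij_betw_combine[OF 1 lab_both_W]) auto
  also have "{B+1..N-q} \<union> {N-q+1..N} = {B+1..N}" using z by auto
  finally show ?thesis by (simp only: W_eq[symmetric])
qed

lemma dir: "dir j \<in> {1, - 1}" "dir 0 = 1"
  using spine by (simp_all add: spine_labels_def)

lemma lam_ge_1: "j < K \<Longrightarrow> 1 \<le> lam j"
  using spine bij_betwE[of lam "{..<K}" "{1..int K}"] by (auto simp: spine_labels_def)

lemma lam_sum: "0 < i \<Longrightarrow> i < K \<Longrightarrow> 3 \<le> lam (i - 1) + lam i"
proof -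
  assume i: "0 < i" "i < K"
  have "inj_on lam {..<K}" using spine by (simp add: spine_labels_def bij_betw_def)
  then have "lam (i - 1) \<noteq> lam i"
    using i inj_onD[of lam "{..<K}" "i - 1" i] by (metis One_nat_def Suc_pred lessI less_imp_diff_less lessThan_iff nat_less_le)
  then show ?thesis using lam_ge_1[of i] lam_ge_1[of "i - 1"] i by linarith
qed

lemma pass: "0 < i \<Longrightarrow> i < K \<Longrightarrow> i \<notin> I_none \<Longrightarrow> dir i = dir (i - 1) \<and> dir i * (lam (i - 1) - lam i) = 1"
proof -
  have "\<forall>i. 0 < i \<longrightarrow> i < K \<longrightarrow> i \<notin> I_none \<longrightarrow> dir i = dir (i - 1) \<and> dir i * (lam (i - 1) - lam i) = 1"
    using spine unfolding spine_labels_def by (elim conjE) assumption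
  then show "0 < i \<Longrightarrow> i < K \<Longrightarrow> i \<notin> I_none \<Longrightarrow> dir i = dir (i - 1) \<and> dir i * (lam (i - 1) - lam i) = 1"
    by blast
qed

lemma turn: "i \<in> I_none \<Longrightarrow> dir i = - dir (i - 1)"
proof -
  have "\<forall>i. 0 < i \<longrightarrow> i < K \<longrightarrow> i \<in> I_none \<longrightarrow> dir i = - dir (i - 1)"
    using spine unfolding spine_labels_def by (elim conjE) assumption
  then show "i \<in> I_none \<Longrightarrow> dir i = - dir (i - 1)" using I_interior[of i] by blast
qed

lemma sval_pass:
  assumes "0 < i" "i < K" "i \<notin> I_none"
  shows "sval i = 1 + pair_sum lab s i + (if i \<in> I_A \<union> I_both then lab (sA i) else 0)
    + (if i \<in> I_W \<union> I_both then lab (sW i) else 0)"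
proof -
  have "dir (i - 1) * (N + lam (i - 1)) - dir i * (N + lam i) = 1"
  proof -
    have "dir (i - 1) = dir i" "dir i * (lam (i - 1) - lam i) = 1"
      using pass[OF assms] by metis+
    then show ?thesis by (simp add: algebra_simps)
  qed
  moreover have "i \<notin> I_end" using assms I_end_subset by auto
  ultimately show ?thesis
    using assms s_sA[of i] s_sW[of i]
    by (auto simp: spine_val_def sum_A_at sum_W_at pair_sum_def)
qed

lemma lab_sA: "i \<in> I_A \<Longrightarrow> T + 1 \<le> lab (sA i) \<and> lab (sA i) \<le> B"
  using bij_betwE[OF lab_A] by auto

lemma lab_sW: "i \<in> I_W \<Longrightarrow> B + 1 \<le> lab (sW i) \<and> lab (sW i) \<le> H"
  using bij_betwE[OF lab_W] by auto

lemma lab_sA_both: "i \<in> I_both \<Longrightarrow> M + 1 \<le> lab (sA i) \<and> lab (sA i) \<le> M + q"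
  using bij_betwE[OF lab_both] by auto

lemma lab_sW_both: "i \<in> I_both \<Longrightarrow> N - q + 1 \<le> lab (sW i) \<and> lab (sW i) \<le> N"
  using bij_betwE[OF lab_both_W] by auto

lemma sval_I_A:
  assumes "i \<in> I_A"
  shows "sval i = 1 + pair_sum lab s i + lab (sA i)" "T < sval i" "sval i \<le> B + 1"
proof -
  have i: "0 < i" "i < K" "i \<notin> I_none" "i \<notin> I_W \<union> I_both" using assms by (auto simp: I_defs)
  show e: "sval i = 1 + pair_sum lab s i + lab (sA i)" using sval_pass[OF i(1-3)] assms i(4) by simp
  have "pair_sign dir i = - 1" using i by (simp add: pair_sign_def)
  then have "pair_sum lab s i \<in> {0, -1}" using pairs[of i] i by simp
  then show "T < sval i" "sval i \<le> B + 1" using e lab_sA[OF assms] by auto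
qed

lemma sval_I_W:
  assumes "i \<in> I_W"
  shows "sval i = 1 + pair_sum lab s i + lab (sW i)" "B + 2 \<le> sval i" "sval i \<le> H + 2"
proof -
  have i: "0 < i" "i < K" "i \<notin> I_none" "i \<notin> I_A \<union> I_both" using assms by (auto simp: I_defs)
  show e: "sval i = 1 + pair_sum lab s i + lab (sW i)" using sval_pass[OF i(1-3)] assms i(4) by simp
  have "pair_sign dir i = 1" using i assms by (simp add: pair_sign_def)
  then have "pair_sum lab s i \<in> {0, 1}" using pairs[of i] i by simp
  then show "B + 2 \<le> sval i" "sval i \<le> H + 2" using e lab_sW[OF assms] by auto
qed

text \<open>The values fill a window around N + M. Positive values in \<open>W\<close> stop at N - q
  + M, since the top \<open>q\<close> labels of \<open>W\<close> are reserved for \<open>sW\<close>;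
  turns and ends start at N + M + q + 2 in absolute value.\<close>

lemma sval_I_both:
  assumes "i \<in> I_both"
  shows "sval i = 1 + pair_sum lab s i + lab (sA i) + lab (sW i)"
    "M + N - q + 2 \<le> sval i" "sval i \<le> N + M + q + 1"
proof -
  have i: "0 < i" "i < K" "i \<notin> I_none" "i \<notin> I_A \<union> I_W" using assms by (auto simp: I_defs)
  show e: "sval i = 1 + pair_sum lab s i + lab (sA i) + lab (sW i)"
    using sval_pass[OF i(1-3)] assms i(4) by simp
  have "pair_sign dir i = - 1" using i by (simp add: pair_sign_def)
  then have "pair_sum lab s i \<in> {0, -1}" using pairs[of i] i by simp
  then show "M + N - q + 2 \<le> sval i" "sval i \<le> N + M + q + 1"
    using e lab_sA_both[OF assms] lab_sW_both[OF assms] by auto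
qed

text \<open>At a turn both spine edges enter or both leave, and \<open>pair_sign\<close> agrees with
  them, so nothing is lost from the absolute value.\<close>

lemma sval_I_none:
  assumes "i \<in> I_none"
  obtains y where "y \<in> {0, 1}" "sval i = dir (i - 1) * (2 * N + lam (i - 1) + lam i + y)"
proof -
  have i: "0 < i" "i < K" "i \<notin> I_A \<union> I_both" "i \<notin> I_W \<union> I_both" "i \<notin> {0, K}"
    using assms by (auto simp: I_defs)
  then have "i \<notin> I_end" using I_end_subset by blast
  then have e: "sval i = dir (i - 1) * (2 * N + lam (i - 1) + lam i) + pair_sum lab s i"
    using i turn[OF assms]
    by (auto simp: spine_val_def sum_A_at sum_W_at pair_sum_def algebra_simps)
  have "pair_sign dir i = dir (i - 1)" using i assms by (simp add: pair_sign_def)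
  then have "pair_sum lab s i \<in> {0, dir (i - 1)}" using pairs[of i] i by simp
  then have "sval i = dir (i - 1) * (2 * N + lam (i - 1) + lam i + 0) \<or>
      sval i = dir (i - 1) * (2 * N + lam (i - 1) + lam i + 1)"
    using e by (auto simp: distrib_left)
  then show ?thesis using that by blast
qed

text \<open>The spine edge, \<open>sA 0\<close> and \<open>tA 0\<close> all point away from vertex
  0. If \<open>tA 0\<close> is set apart, its label 1 together with a pair sum of 0 or 1 costs at
  most one unit; otherwise the pair sum itself is 0 or -1.\<close>

lemma sval_0:
  obtains z where "z \<in> {0, 1}" "sval 0 = - (N + lam 0 + lab (sA 0) + z)"
proof -
  have 0: "0 \<notin> I_W \<union> I_both" "0 < K" using K_ge_2 by (auto simp: I_defs)
  have e: "sval 0 = - (N + lam 0) - lab (sA 0) + (if 0 \<in> I_end then - 1 else 0) + pair_sum lab s 0"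
    using 0 s_end(1,2) lab_tA_0 dir
    by (auto simp: spine_val_def sum_A_at sum_W_at pair_sum_def)
  show ?thesis
  proof (cases "0 \<in> I_end")
    case True
    then have "pair_sum lab s 0 \<in> {0, 1}" using pairs[of 0] by (simp add: pair_sign_def)
    then show ?thesis using e True that[of "1 - pair_sum lab s 0"] by auto
  next
    case False
    then have "pair_sum lab s 0 \<in> {0, -1}" using pairs[of 0] by (simp add: pair_sign_def)
    then show ?thesis using e False that[of "- pair_sum lab s 0"] by auto
  qed
qed

text \<open>One \<open>z\<close> serves all labellings that agree at \<open>tA K\<close> and on the
  pair sum, which makes the values at \<open>K\<close> before and after the exchange of end labels
  comparable. In contrast to vertex 0, \<open>z\<close> is not limited to one unit, as
  \<open>tA K\<close> may carry any label up to \<open>D\<close>; hence a turn may collide with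
  \<open>K\<close>.\<close>

lemma sval_K:
  obtains z where "0 \<le> z" "\<And>l'. (K \<in> I_end \<Longrightarrow> l' (tA K) = lab (tA K)) \<Longrightarrow> pair_sum l' s K = pair_sum lab s K \<Longrightarrow>
    spine_val l' s lam dir K = dir (K - 1) * (N + lam (K - 1) + l' (sA K) + z)"
proof -
  have K: "K \<notin> I_W \<union> I_both" "0 < K" "K \<noteq> 0" using K_ge_2 by (auto simp: I_defs)
  have ps: "pair_sum lab s K \<in> {0, dir (K - 1)}" using pairs[of K] K by (simp add: pair_sign_def)
  have t: "0 \<le> lab (tA K)" if "K \<in> I_end" using bij_betwE[OF lab_R] that by force
  define z where "z = (if K \<in> I_end then lab (tA K) else 0) + dir (K - 1) * pair_sum lab s K"
  have dd: "dir (K - 1) * dir (K - 1) = 1" using dir(1)[of "K - 1"] by auto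
  have "0 \<le> z" using ps t dd by (auto simp: z_def)
  moreover have "spine_val l' s lam dir K = dir (K - 1) * (N + lam (K - 1) + l' (sA K) + z)"
    if "K \<in> I_end \<Longrightarrow> l' (tA K) = lab (tA K)" "pair_sum l' s K = pair_sum lab s K" for l'
  proof -
    have "spine_val l' s lam dir K = dir (K - 1) * (N + lam (K - 1)) + dir (K - 1) * l' (sA K)
        + (if K \<in> I_end then dir (K - 1) * lab (tA K) else 0) + pair_sum l' s K"
      using K s_end(3,4) that(1)
      by (auto simp: spine_val_def sum_A_at sum_W_at pair_sum_def)
    moreover have "dir (K - 1) * (dir (K - 1) * pair_sum lab s K) = pair_sum lab s K"
      using dd by (simp flip: mult.assoc)
    ultimately show ?thesis using that by (simp add: z_def distrib_left)
  qed
  ultimately show ?thesis using that by blast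
qed

lemma lab_end_bounds: "M + q + 1 \<le> lab (sA 0)" "lab (sA 0) \<le> N" "M + q + 1 \<le> lab (sA K)"
  using lab_ends zone_order by (auto simp: doubleton_eq_iff)

text \<open>The end labels start at M + q + 1 precisely to lift both ends above
  \<open>I_both\<close>. A turn has at least 2N + 3, and \<open>N\<close> is at least M + q +
  2.\<close>

lemma sval_outer:
  assumes "i \<in> I_none \<or> i = 0 \<or> i = K"
  shows "N + M + q + 2 \<le> \<bar>sval i\<bar>"
proof -
  have dabs: "\<bar>dir j * x\<bar> = \<bar>x\<bar>" for j x using dir(1)[of j] by (auto simp: abs_mult)
  consider "i \<in> I_none" | "i = 0" | "i = K" using assms by blast
  then show ?thesis
  proof cases
    case 1
    then obtain y where y: "y \<in> {0, 1}" "sval i = dir (i - 1) * (2 * N + lam (i - 1) + lam i + y)"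
      by (rule sval_I_none)
    have "3 \<le> lam (i - 1) + lam i" using 1 by (intro lam_sum) (auto simp: I_defs)
    then show ?thesis using y zone_order by (auto simp: dabs)
  next
    case 2
    obtain z where "z \<in> {0, 1}" "sval 0 = - (N + lam 0 + lab (sA 0) + z)" by (rule sval_0)
    then show ?thesis using 2 lab_end_bounds lam_ge_1[of 0] K_ge_2 zone_order by auto
  next
    case 3
    obtain z where "0 \<le> z" "sval K = dir (K - 1) * (N + lam (K - 1) + lab (sA K) + z)"
      using sval_K by metis
    then show ?thesis using 3 lab_end_bounds lam_ge_1[of "K - 1"] K_ge_2 zone_order by (simp add: dabs)
  qed
qed

lemma turn_gap:
  assumes "i \<in> I_none" "j \<in> I_none" "i < j" "dir (i - 1) = dir (j - 1)"
  shows "lam (i - 1) + lam i + 4 \<le> lam (j - 1) + lam j"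
proof -
  have "dir i = dir j" using turn assms by simp
  then show ?thesis using spine assms unfolding spine_labels_def by (auto simp: I_none_def)
qed

lemma turn_near:
  assumes "i \<in> I_none" "dir (i - 1) = - 1"
  shows "lam 0 + 4 \<le> lam (i - 1) + lam i"
proof -
  have "dir i = 1" using turn assms by simp
  then show ?thesis using spine assms unfolding spine_labels_def by (auto simp: I_none_def)
qed

text \<open>Turns of opposite direction have values of opposite sign. For equal directions the gap
  of 4 in the spine labels outweighs the unit that the pairs may add.\<close>

lemma sval_I_none_eq:
  assumes "i \<in> I_none" "j \<in> I_none" "sval i = sval j"
  shows "i = j"
proof -
  obtain y where y: "y \<in> {0, 1}" "sval i = dir (i - 1) * (2 * N + lam (i - 1) + lam i + y)"
    using assms(1) by (rule sval_I_none)
  obtain z where z: "z \<in> {0, 1}" "sval j = dir (j - 1) * (2 * N + lam (j - 1) + lam j + z)"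
    using assms(2) by (rule sval_I_none)
  have N0: "0 \<le> N" using zone_order by linarith
  have 3: "3 \<le> lam (i - 1) + lam i" "3 \<le> lam (j - 1) + lam j"
    using assms lam_sum I_interior by blast+
  have "dir (i - 1) = dir (j - 1)"
    using assms(3) y z 3 N0 dir(1)[of "i - 1"] dir(1)[of "j - 1"] by auto
  moreover from this have "lam (i - 1) + lam i + y = lam (j - 1) + lam j + z"
    using assms(3) y z dir(1)[of "i - 1"] by auto
  ultimately show ?thesis
    using turn_gap[of i j] turn_gap[of j i] assms(1,2) y z by (cases i j rule: linorder_cases) auto
qed

text \<open>A negative turn has absolute value at least 2N + lam 0 + 4 by \<open>turn_near\<close>,
  while vertex 0 has at most 2N + lam 0 + 1, because \<open>lab (sA 0)\<close> is at most
  \<open>N\<close>.\<close>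

lemma sval_0_I_none:
  assumes "i \<in> I_none"
  shows "sval i \<noteq> sval 0"
proof
  assume eq: "sval i = sval 0"
  obtain y where y: "y \<in> {0, 1}" "sval i = dir (i - 1) * (2 * N + lam (i - 1) + lam i + y)"
    using assms(1) by (rule sval_I_none)
  obtain z where z: "z \<in> {0, 1}" "sval 0 = - (N + lam 0 + lab (sA 0) + z)" by (rule sval_0)
  have N0: "0 \<le> N" using zone_order by linarith
  have "3 \<le> lam (i - 1) + lam i" using assms lam_sum I_interior by blast
  moreover have "1 \<le> lam 0" using lam_ge_1 K_ge_2 by simp
  ultimately have "dir (i - 1) = - 1"
    using eq y z N0 lab_end_bounds zone_order dir(1)[of "i - 1"] by auto
  then show False using turn_near[OF assms] eq y z lab_end_bounds by auto
qed

text \<open>The values at \<open>I_A\<close>, \<open>I_W\<close> and \<open>I_both\<close> lie in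
  disjoint windows, below the absolute values of turns and ends; inside a window the order of
  assignment separates them. Only collisions with \<open>K\<close> escape this and are left to
  \<open>far\<close>.\<close>

lemma inj_sval:
  assumes far: "\<And>i. i \<in> I_none \<or> i = 0 \<Longrightarrow> sval i \<noteq> sval K"
  shows "inj_on sval {..K}"
proof (rule inj_onI)
  fix i j assume ij: "i \<in> {..K}" "j \<in> {..K}" and eq: "sval i = sval j"
  note z = zone_order and A = sval_I_A and W = sval_I_W and O = sval_I_both and E = sval_outer
  have M1: "1 \<le> M" if "k \<in> I_W" for k using sW[of k] that M_ge_1 by blast
  have outer: "k \<in> I_A \<or> k \<in> I_W \<or> k \<in> I_both \<or> (k \<in> I_none \<or> k = 0 \<or> k = K)" if "k \<le> K" for k
    using that I_cases by blast
  have cA: "l \<in> I_A" if "k \<in> I_A" "l \<le> K" "sval k = sval l" for k l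
  proof -
    note k = A(2,3)[OF that(1)] that(3) z
    have "l \<notin> I_W" using k W(2)[of l] by force
    moreover have "l \<notin> I_both" using k O(2)[of l] by force
    moreover have "\<not> (l \<in> I_none \<or> l = 0 \<or> l = K)" using k E[of l] by linarith
    ultimately show ?thesis using outer[OF that(2)] by blast
  qed
  have cW: "l \<in> I_W" if "k \<in> I_W" "l \<le> K" "sval k = sval l" for k l
  proof -
    note k = W(2,3)[OF that(1)] that(3) z M1[OF that(1)]
    have "l \<notin> I_A" using k A(3)[of l] by force
    moreover have "l \<notin> I_both" using k O(2)[of l] by force
    moreover have "\<not> (l \<in> I_none \<or> l = 0 \<or> l = K)" using k E[of l] by linarith
    ultimately show ?thesis using outer[OF that(2)] by blast
  qed
  have cO: "l \<in> I_both" if "k \<in> I_both" "l \<le> K" "sval k = sval l" for k l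
  proof -
    note k = O(2,3)[OF that(1)] that(3) z
    have "l \<notin> I_A" using k A(3)[of l] by force
    moreover have "l \<notin> I_W" using k W(3)[of l] M1[of l] by force
    moreover have "\<not> (l \<in> I_none \<or> l = 0 \<or> l = K)" using k E[of l] by linarith
    ultimately show ?thesis using outer[OF that(2)] by blast
  qed
  consider "i \<in> I_A" | "i \<in> I_W" | "i \<in> I_both" |
      "i \<in> I_none \<or> i = 0 \<or> i = K" "j \<in> I_none \<or> j = 0 \<or> j = K"
    using outer[of i] outer[of j] cA[of j i] cW[of j i] cO[of j i] ij eq by auto
  then show "i = j"
  proof cases
    case 1
    then have "j \<in> I_A" using cA[of i j] ij eq by simp
    then show ?thesis using A(1) 1 eq inj_onD[OF inj_I_A, of i j] by simp
  next
    case 2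
    then have "j \<in> I_W" using cW[of i j] ij eq by simp
    then show ?thesis using W(1) 2 eq inj_onD[OF inj_I_W, of i j] by simp
  next
    case 3
    then have "j \<in> I_both" using cO[of i j] ij eq by simp
    then show ?thesis using O(1) 3 eq inj_onD[OF inj_I_both, of i j] by simp
  next
    case 4
    then show ?thesis
      using eq far[of i] far[of j] sval_I_none_eq[of i j] sval_0_I_none[of i] sval_0_I_none[of j] by metis
  qed
qed

section \<open>Values off the spine\<close>

lemma nval_A_F: "v \<in> A \<union> F \<Longrightarrow> nval v = - s v * lab v"
proof -
  assume "v \<in> A \<union> F"
  then have "{f. f \<in> F \<and> own f = v} = {}" using own_F disj by auto
  then have "(\<Sum>f | f \<in> F \<and> own f = v. s f * lab f) = 0" by (simp only: sum.empty)
  then show ?thesis by (simp add: node_val_def)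
qed

lemma abs_nval_A_F: "v \<in> A \<union> F \<Longrightarrow> \<bar>nval v\<bar> = lab v \<and> 1 \<le> lab v \<and> lab v \<le> B"
proof -
  assume v: "v \<in> A \<union> F"
  then have "s v = 1 \<or> s v = - 1" "lab v \<in> {1..B}" using sgn[of v] bij_betwE[OF lab_A_F] by auto
  then show ?thesis using nval_A_F[OF v] by auto
qed

lemma nval_W: "w \<in> W \<Longrightarrow> nval w = - s w * (lab w + rest_sum lab s w + lab (fW w))"
proof -
  assume w: "w \<in> W"
  have "s w * s w = 1" using sgn[of w] w by auto
  then have "- s w * rest_sum lab s w = (\<Sum>f\<in>R_at w. s f * lab f)"
    by (simp add: rest_sum_def flip: mult.assoc)
  then show ?thesis using w by (simp add: node_val_def sum_own s_fW algebra_simps)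
qed

lemma W_bounds:
  assumes "w \<in> W"
  shows "B + 1 \<le> lab w" "lab w \<le> N" "1 \<le> rest_sum lab s w + lab (fW w)" "rest_sum lab s w + lab (fW w) \<le> M"
proof -
  show "B + 1 \<le> lab w" "lab w \<le> N" using bij_betwE[OF lab_W_all] assms by auto
  have "D + 1 \<le> lab (fW w)" "lab (fW w) \<le> M" using bij_betwE[OF lab_fW] assms by auto
  then show "1 \<le> rest_sum lab s w + lab (fW w)" "rest_sum lab s w + lab (fW w) \<le> M"
    using rests[OF assms] by linarith+
qed

lemma abs_nval_W:
  assumes "w \<in> W"
  shows "B + 2 \<le> \<bar>nval w\<bar>" "\<bar>nval w\<bar> \<le> N + M"
  using nval_W[OF assms] sgn[of w] W_bounds[OF assms] abs_nval_A_F zone_order assms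
  by (auto simp: abs_if)

lemma inj_nval: "inj_on nval (A \<union> W \<union> F)"
proof (rule inj_onI)
  fix u v assume uv: "u \<in> A \<union> W \<union> F" "v \<in> A \<union> W \<union> F" and eq: "nval u = nval v"
  show "u = v"
  proof (cases "u \<in> W")
    case True
    then have vW: "v \<in> W" using abs_nval_W[of u] abs_nval_A_F[of v] uv eq by force
    have "s u = s v"
      using eq nval_W[OF True] nval_W[OF vW] W_bounds[OF True] W_bounds[OF vW] sgn[OF uv(1)] sgn[OF uv(2)]
        zone_order by auto
    then show ?thesis using inj_W[OF True vW] eq nval_W[OF True] nval_W[OF vW] sgn[OF uv(1)] by auto
  next
    case False
    then have u: "u \<in> A \<union> F" using uv by blast
    then have v: "v \<in> A \<union> F" using abs_nval_W[of v] abs_nval_A_F[of u] uv eq by force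
    have "lab u = lab v" using abs_nval_A_F[OF u] abs_nval_A_F[OF v] eq by simp
    then show ?thesis using lab_A_F u v by (auto simp: bij_betw_def inj_on_def)
  qed
qed

text \<open>At \<open>I_A\<close>, \<open>I_W\<close> and \<open>I_both\<close> the spine value is
  positive, so only edges of sign -1 matter off the spine. The left-over children there have sign 1,
  which removes exactly the labels that could produce the same value. Turns and ends exceed N + M in
  absolute value, the bound for all values off the spine.\<close>

lemma sval_neq_nval:
  assumes i: "i \<le> K" and v: "v \<in> A \<union> W \<union> F"
  shows "sval i \<noteq> nval v"
proof
  assume eq: "sval i = nval v"
  note z = zone_order
  have pos_cases: "v \<in> PW" if "v \<in> W" "0 < nval v"
  proof -
    have "s v \<noteq> 1" using that nval_W[of v] W_bounds[of v] z by auto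
    then show ?thesis using that s_sW by (auto simp: PW_def)
  qed
  from i show False
  proof (cases rule: I_cases)
    case 4
    note A = sval_I_A[OF 4]
    show ?thesis
    proof (cases "v \<in> W")
      case True
      then show ?thesis using abs_nval_W[OF True] A eq z by linarith
    next
      case False
      then have vAF: "v \<in> A \<union> F" using v by blast
      then have l: "s v = - 1" "T < lab v" using nval_A_F[of v] abs_nval_A_F[of v] sgn[OF v] A eq z by auto
      have "v \<in> sA ` I_A"
      proof (rule ccontr)
        assume "v \<notin> sA ` I_A"
        then consider "v \<in> R \<union> tA ` I_end" | "v \<in> fW ` W" | "v \<in> sA ` I_both" | "v \<in> {sA 0, sA K}" | "v \<in> PA"
          using vAF unfolding A_F_eq by blast
        then have "lab v \<le> T"
        proof cases
          case 4
          then have "lab v \<in> {M+q+1, M+q+2}" unfolding lab_ends[symmetric] by blast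
          then show ?thesis using z by auto
        next
          case 1
          then show ?thesis using bij_betwE[OF lab_R] z by force
        next
          case 2
          then show ?thesis using bij_betwE[OF lab_fW] z by force
        next
          case 3
          then show ?thesis using bij_betwE[OF lab_both] z by force
        next
          case 5
          then show ?thesis using bij_betwE[OF lab_PA] z by force
        qed
        then show False using l by simp
      qed
      then show ?thesis using s_sA l by auto
    qed
  next
    case 5
    note W = sval_I_W[OF 5]
    have vW: "v \<in> W" using abs_nval_A_F[of v] W eq v z by force
    then have vP: "v \<in> PW" using pos_cases W eq z by auto
    then have "H + 1 \<le> lab v" using bij_betwE[OF lab_PW] by auto
    moreover have sv: "s v = - 1"
      using sgn[OF v] nval_W[OF vW] W_bounds[OF vW] W eq z by auto
    \<comment> \<open>The vertex \<open>sW i\<close> has sign 1, so \<open>large_fW\<close> applies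
      and the value at \<open>v\<close> is at least (H + 1) - D + (D + 2) = H + 3, one above the
      bound for \<open>I_W\<close>.\<close>
    moreover have "D + 2 \<le> lab (fW v)" using large_fW[OF vW sv, of "sW i"] sW[of i] s_sW[of i] 5 by auto
    ultimately show False using nval_W[OF vW] rests[OF vW] W eq by auto
  next
    case 6
    note O = sval_I_both[OF 6]
    have vW: "v \<in> W" using abs_nval_A_F[of v] O eq v z by force
    then have vP: "v \<in> PW" using pos_cases O eq z by auto
    then have "lab v \<le> N - q" using bij_betwE[OF lab_PW] by auto
    moreover have "s v = - 1" using sgn[OF v] nval_W[OF vW] W_bounds[OF vW] O eq z by auto
    ultimately show False using nval_W[OF vW] W_bounds[OF vW] O eq by auto
  qed (use sval_outer[of i] abs_nval_W[of v] abs_nval_A_F[of v] v eq z in \<open>force\<close>)+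
qed

text \<open>
  At most one turn can collide with the last spine vertex. Exchanging the consecutive labels of
  \<open>sA 0\<close> and \<open>sA K\<close> then moves the value at \<open>K\<close> by one, while equal signs force turns to be at least
  three apart.
\<close>

lemma lam_far:
  assumes "dir (K - 1) = - 1"
  shows "lam 0 + 1 \<le> lam (K - 1)" "i \<in> I_none \<Longrightarrow> dir (i - 1) = - 1 \<Longrightarrow> lam 0 + 3 \<le> lam (K - 1)"
proof -
  show "lam 0 + 1 \<le> lam (K - 1)" using spine assms by (simp add: spine_labels_def)
  have "\<forall>i. 0 < i \<longrightarrow> i < K \<longrightarrow> i \<in> I_none \<longrightarrow> dir i = 1 \<longrightarrow> lam 0 + 3 \<le> lam (K - 1)"
    using spine assms by (simp add: spine_labels_def)
  then show "i \<in> I_none \<Longrightarrow> dir (i - 1) = - 1 \<Longrightarrow> lam 0 + 3 \<le> lam (K - 1)"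
    using turn[of i] I_interior[of i] by fastforce
qed

definition "lab' v = (if v = sA 0 then lab (sA K) else if v = sA K then lab (sA 0) else lab v)"

lemma lab'_ends: "lab' (sA 0) = lab (sA K)" "lab' (sA K) = lab (sA 0)"
  using sA_0_K by (auto simp: lab'_def)

lemma lab'_eq: "v \<noteq> sA 0 \<Longrightarrow> v \<noteq> sA K \<Longrightarrow> lab' v = lab v"
  by (simp add: lab'_def)

lemma lab'_other:
  "v \<in> R \<union> tA ` I_end \<union> fW ` W \<union> sA ` I_both \<union> PA \<union> sA ` I_A \<union> W \<Longrightarrow> lab' v = lab v"
proof (rule lab'_eq)
  have W: "sA 0 \<notin> W" "sA K \<notin> W" using sA(1)[of 0] sA(1)[of K] disj by auto
  assume v: "v \<in> R \<union> tA ` I_end \<union> fW ` W \<union> sA ` I_both \<union> PA \<union> sA ` I_A \<union> W"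
  have e: "u \<notin> R \<union> tA ` I_end \<union> fW ` W \<union> sA ` I_both" "u \<notin> PA" "u \<notin> sA ` I_A" if "u \<in> {sA 0, sA K}" for u
  proof -
    show "u \<notin> R \<union> tA ` I_end \<union> fW ` W \<union> sA ` I_both" using zones_disjoint(3) that by (metis disjoint_iff)
    show "u \<notin> PA" using zones_disjoint(4) that by (metis disjoint_iff UnI2)
    show "u \<notin> sA ` I_A" using zones_disjoint(5) that by (metis disjoint_iff UnI1 UnI2)
  qed
  show "v \<noteq> sA 0" using e[of "sA 0"] W(1) v by auto
  show "v \<noteq> sA K" using e[of "sA K"] W(2) v by auto
qed

lemma lab'_pair_sum: "pair_sum lab' s i = pair_sum lab s i"
  by (simp add: pair_sum_def PA_at_def PW_at_def PW_def lab'_other)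

lemma lab'_rest_sum: "rest_sum lab' s w = rest_sum lab s w"
  by (simp add: rest_sum_def R_at_def lab'_other)

text \<open>Among the conditions on labels only \<open>lab_ends\<close> involves those of
  \<open>sA 0\<close> and \<open>sA K\<close>, and it is symmetric in them.\<close>

lemma swapped: "lobster_labelling K A W F pos own lab' s lam dir"
proof
  have bij: "bij_betw lab' X Y"
    if "bij_betw lab X Y" "X \<subseteq> R \<union> tA ` I_end \<union> fW ` W \<union> sA ` I_both \<union> PA \<union> sA ` I_A \<union> W" for X Y
    using that(1) by (rule bij_betw_cong[THEN iffD1, rotated]) (use that(2) lab'_other in auto)
  show "bij_betw lab' (R \<union> tA ` I_end) {1..D}" by (rule bij[OF lab_R]) auto
  show "bij_betw lab' (fW ` W) {D+1..M}" by (rule bij[OF lab_fW]) auto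
  show "bij_betw lab' (sA ` I_both) {M+1..M+q}" by (rule bij[OF lab_both]) auto
  show "bij_betw lab' PA {M+q+2+1..T}" by (rule bij[OF lab_PA]) auto
  show "bij_betw lab' (sA ` I_A) {T+1..B}" by (rule bij[OF lab_A]) auto
  show "bij_betw lab' (sW ` I_W) {B+1..H}"
    by (rule bij[OF lab_W], rule le_supI2, rule image_subsetI, rule sW(1), rule UnI1)
  show "bij_betw lab' PW {H+1..N-q}" by (rule bij[OF lab_PW]) (auto simp: PW_def)
  show "bij_betw lab' (sW ` I_both) {N-q+1..N}"
    by (rule bij[OF lab_both_W], rule le_supI2, rule image_subsetI, rule sW(1), rule UnI2)
  show "{lab' (sA 0), lab' (sA K)} = {M+q+1, M+q+2}" using lab_ends by (simp add: lab'_ends insert_commute)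
  show "0 \<in> I_end \<Longrightarrow> lab' (tA 0) = 1" using lab_tA_0 lab'_other[of "tA 0"] by simp
  show "inj_on (\<lambda>i. pair_sum lab' s i + lab' (sA i)) I_A"
    using inj_I_A by (rule inj_on_cong[THEN iffD1, rotated]) (simp add: lab'_other lab'_pair_sum)
  show "inj_on (\<lambda>i. pair_sum lab' s i + lab' (sW i)) I_W"
    using inj_I_W by (rule inj_on_cong[THEN iffD1, rotated]) (simp add: lab'_other lab'_pair_sum sW(1))
  show "inj_on (\<lambda>i. pair_sum lab' s i + lab' (sA i) + lab' (sW i)) I_both"
    using inj_I_both by (rule inj_on_cong[THEN iffD1, rotated]) (simp add: lab'_other lab'_pair_sum sW(1))
  show "pair_sum lab' s i \<in> {0, pair_sign dir i}" if "i \<le> K" for i using pairs[OF that] by (simp add: lab'_pair_sum)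
  show "- D \<le> rest_sum lab' s w \<and> rest_sum lab' s w \<le> 0" if "w \<in> W" for w
    using rests[OF that] by (simp add: lab'_rest_sum)
  show "D + 2 \<le> lab' (fW w)" if "w \<in> W" "s w = - 1" "w' \<in> W" "s w' = 1" for w w'
    using large_fW[OF that] that by (simp add: lab'_other)
  show "w = w'" if "w \<in> W" "w' \<in> W" "s w = s w'"
      "lab' w + rest_sum lab' s w + lab' (fW w) = lab' w' + rest_sum lab' s w' + lab' (fW w')" for w w'
    using inj_W[OF that(1-3)] that by (simp add: lab'_other lab'_rest_sum)
qed (use spine sgn s_sA s_sW s_end s_fW in blast)+

lemma far_or_swapped:
  assumes E: "lab (sA 0) = M + q + 1"
  shows "(\<forall>i. i \<in> I_none \<or> i = 0 \<longrightarrow> sval i \<noteq> sval K) \<or>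
    (\<forall>i. i \<in> I_none \<or> i = 0 \<longrightarrow> spine_val lab' s lam dir i \<noteq> spine_val lab' s lam dir K)"
proof -
  interpret swap: lobster_labelling K A W F pos own lab' s lam dir by (rule swapped)
  have E2: "lab (sA K) = M + q + 2" using lab_ends E by (auto simp: doubleton_eq_iff)
  obtain z where z: "0 \<le> z" and zK: "\<And>l'. (K \<in> I_end \<Longrightarrow> l' (tA K) = lab (tA K)) \<Longrightarrow> pair_sum l' s K = pair_sum lab s K \<Longrightarrow>
    spine_val l' s lam dir K = dir (K - 1) * (N + lam (K - 1) + l' (sA K) + z)"
    using sval_K by blast
  have tK: "lab' (tA K) = lab (tA K)" if "K \<in> I_end" using that by (intro lab'_other) simp
  have vK: "sval K = dir (K - 1) * (N + lam (K - 1) + M + q + 2 + z)" using zK[of lab] E2 by simp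
  obtain z0 where z0: "z0 \<in> {0, 1}" "sval 0 = - (N + lam 0 + (M + q + 1) + z0)" using sval_0 E by metis
  obtain z1 where z1: "z1 \<in> {0, 1}" "spine_val lab' s lam dir 0 = - (N + lam 0 + (M + q + 2) + z1)"
    using swap.sval_0 E2 lab'_ends by metis
  have pos: "0 \<le> N" "0 \<le> M + q" using zone_order by linarith+
  have lam: "1 \<le> lam 0" "1 \<le> lam (K - 1)" using lam_ge_1 K_ge_2 by simp_all
  have dK: "dir (K - 1) = 1 \<or> dir (K - 1) = - 1" using dir(1) by blast
  \<comment> \<open>If both values are negative, \<open>lam_far\<close> gives one unit and the
    larger end label at \<open>K\<close> another, against \<open>z0\<close> of at most 1.\<close>
  have not0: "sval 0 \<noteq> sval K" using z0 vK z pos lam dK lam_far(1) by auto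
  show ?thesis
  proof (cases "\<exists>i\<in>I_none. sval i = sval K")
    case False
    then show ?thesis using not0 by blast
  next
    case True
    then obtain i where i: "i \<in> I_none" "sval i = sval K" by blast
    obtain y where y: "y \<in> {0, 1}" "sval i = dir (i - 1) * (2 * N + lam (i - 1) + lam i + y)"
      using i(1) by (rule sval_I_none)
    have 3: "3 \<le> lam (j - 1) + lam j" if "j \<in> I_none" for j using that lam_sum I_interior by blast
    have di: "dir (i - 1) = dir (K - 1)"
      using i(2) y vK z pos lam 3[OF i(1)] dir(1)[of "i - 1"] dK by auto
    have yi: "2 * N + lam (i - 1) + lam i + y = N + lam (K - 1) + M + q + 2 + z"
      using i(2) y vK di dK by auto
    have vK': "spine_val lab' s lam dir K = dir (K - 1) * (N + lam (K - 1) + M + q + 1 + z)"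
      using zK[of lab'] tK lab'_pair_sum lab'_ends(2) E by simp
    \<comment> \<open>Now 0 has the larger end label, and a lead of one in \<open>lam\<close> no
      longer suffices. If both values are negative, the colliding turn \<open>i\<close> is negative
      too and provides the lead of 3 in \<open>lam_far\<close>.\<close>
    have "spine_val lab' s lam dir 0 \<noteq> spine_val lab' s lam dir K"
      using z1 vK' z pos lam dK lam_far(2)[OF _ i(1)] di by auto
    moreover have "spine_val lab' s lam dir j \<noteq> spine_val lab' s lam dir K" if j: "j \<in> I_none" for j
    proof
      assume eq: "spine_val lab' s lam dir j = spine_val lab' s lam dir K"
      obtain x where x: "x \<in> {0, 1}" "spine_val lab' s lam dir j = dir (j - 1) * (2 * N + lam (j - 1) + lam j + x)"
        using j by (rule swap.sval_I_none)
      \<comment> \<open>The exchange leaves the value at \<open>i\<close> unchanged, so the slack is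
        the same and \<open>i\<close> misses the shifted value at \<open>K\<close>. Any other turn
        of this direction is too far from \<open>i\<close> to be reached by a shift of one.\<close>
      have xy: "x = y" if "i = j"
      proof -
        have "lab' v = lab v" if "v \<in> A_at i" for v
          using that sA(2)[of 0] sA(2)[of K] I_interior[of i] i(1) by (intro lab'_eq) (auto simp: A_at_def)
        moreover have "lab' v = lab v" if "v \<in> W_at i" for v
          using that by (intro lab'_other) (auto simp: W_at_def)
        ultimately have "spine_val lab' s lam dir i = sval i" by (simp add: spine_val_def)
        then show ?thesis using that x y dir(1)[of "i - 1"] by auto
      qed
      have dj: "dir (j - 1) = dir (K - 1)"
        using eq x vK' z pos lam 3[OF j] dir(1)[of "j - 1"] dK by auto
      have "2 * N + lam (j - 1) + lam j + x = N + lam (K - 1) + M + q + 1 + z"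
        using eq x vK' dj dK by auto
      then show False
        using yi xy turn_gap[OF i(1) j] turn_gap[OF j i(1)] di dj x y by (cases i j rule: linorder_cases) auto
    qed
    ultimately show ?thesis by blast
  qed
qed

end

subsection \<open>Existence of a labelling\<close>

lemma bij_betw_image_comp:
  assumes "bij_betw h I X" "inj_on f I" "\<And>i. i \<in> I \<Longrightarrow> g (f i) = h i"
  shows "bij_betw g (f ` I) X"
proof -
  have "bij_betw (g \<circ> f) I X"
    using assms(1) by (rule bij_betw_cong[THEN iffD1, rotated]) (simp add: assms(3))
  then show ?thesis using assms(2) bij_betw_comp_iff[of f I "f ` I" g X] by (simp add: inj_on_imp_bij_betw)
qed

context lobster_skeleton
begin

lemma card_W_eq: "card W = card I_W + card PW + card I_both"
proof -
  have fI: "finite (sW ` I_W)" "finite PW" "finite (sW ` I_both)" using finite_I finite_at by auto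
  have "card W = card (sW ` I_W \<union> PW) + card (sW ` I_both)"
    using fI zones_disjoint(7) by (subst W_eq, subst card_Un_disjoint) auto
  also have "\<dots> = card (sW ` I_W) + card PW + card (sW ` I_both)"
    using fI zones_disjoint(6) by (simp add: card_Un_disjoint)
  finally show ?thesis
    using inj_on_subset[OF inj_sW, of I_W] inj_on_subset[OF inj_sW, of I_both] by (simp add: card_image)
qed

lemma pair_sign_range: "(\<And>j. dir j \<in> {1, - 1}) \<Longrightarrow> pair_sign dir i \<in> {1, - 1}"
  by (simp add: pair_sign_def)

text \<open>No choice is circular: \<open>pair_sign\<close> depends only on \<open>dir\<close>, the
  unit wanted from pairs in \<open>W\<close> on the pairs in \<open>A\<close>, the order of the
  left-over labels on the pair sums, and the order of the labels of \<open>fW\<close> on the labels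
  in \<open>W\<close> and the balanced leaf sums.\<close>

lemma ex_labelling: "\<exists>lab s lam dir. lobster_labelling K A W F pos own lab s lam dir \<and> lab (sA 0) = M + q + 1"
proof -
  obtain lam dir where spine: "spine_labels K (\<lambda>i. i \<in> I_none) 1 lam dir"
    using ex_spine_labels[where K = K and d = 1 and turn = "\<lambda>i. i \<in> I_none"] K_ge_2 by auto
  have dir: "\<And>j. dir j \<in> {1, - 1}" using spine by (simp add: spine_labels_def)
  obtain l0 where l0: "bij_betw l0 (R \<union> tA ` I_end) {1..D}" "tA 0 \<in> R \<union> tA ` I_end \<Longrightarrow> l0 (tA 0) = 1"
    using ex_labels_from_one[of "R \<union> tA ` I_end" "tA 0"] finite_at finite_I by (auto simp: D_def)
  obtain l1 where l1: "bij_betw l1 I_both {M+1..M+q}"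
    using ex_labels_sum_inj[of I_both M] finite_I unfolding q_def by blast
  have "\<exists>lab s. bij_betw lab PA {M+q+2+1..M+q+2 + int (card PA)} \<and> (\<forall>x. s x \<in> {1, - 1}) \<and>
      (\<forall>i. (\<Sum>x | x \<in> PA \<and> pos x = i. s x * lab x) \<in> {0, pair_sign dir i})"
    by (rule ex_paired_labels) (use even_PA_at pair_sign_range[OF dir] finite_at in \<open>simp_all add: PA_at_def\<close>)
  then obtain l2 s2 where l2: "bij_betw l2 PA {M+q+2+1..T}" "\<And>x. s2 x \<in> {1, - 1}"
      "\<And>i. (\<Sum>x\<in>PA_at i. s2 x * l2 x) \<in> {0, pair_sign dir i}"
    unfolding T_def PA_at_def by blast
  \<comment> \<open>If the pairs in \<open>A\<close> have already produced the unit, those in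
    \<open>W\<close> may only take it back; so the total is again 0 or
    \<open>pair_sign dir i\<close>.\<close>
  define eps where "eps i = (if (\<Sum>x\<in>PA_at i. s2 x * l2 x) = 0 then pair_sign dir i else - pair_sign dir i)" for i
  have eps: "eps i \<in> {1, - 1}" for i
    using pair_sign_range[where dir = dir and i = i, OF dir] by (auto simp: eps_def)
  have "\<exists>lab s. bij_betw lab PW {H+1..H + int (card PW)} \<and> (\<forall>x. s x \<in> {1, - 1}) \<and>
      (\<forall>i. (\<Sum>x | x \<in> PW \<and> pos x = i. s x * lab x) \<in> {0, eps i})"
    by (rule ex_paired_labels) (use even_PW_at eps finite_at in \<open>simp_all add: PW_at_def\<close>)
  moreover have "H + int (card PW) = N - q" by (simp add: H_def N_def q_def card_W_eq)
  ultimately obtain l3 s3 where l3: "bij_betw l3 PW {H+1..N-q}" "\<And>x. s3 x \<in> {1, - 1}"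
      "\<And>i. (\<Sum>x\<in>PW_at i. s3 x * l3 x) \<in> {0, eps i}"
    unfolding PW_at_def by auto
  define x where "x i = (\<Sum>x\<in>PA_at i. s2 x * l2 x) + (\<Sum>x\<in>PW_at i. s3 x * l3 x)" for i
  have x: "x i \<in> {0, pair_sign dir i}" for i
    using l2(3)[of i] l3(3)[of i] by (auto simp: x_def eps_def split: if_splits)
  obtain l4 where l4: "bij_betw l4 I_A {T+1..B}" "inj_on (\<lambda>i. x i + l4 i) I_A"
    using ex_labels_sum_inj[of I_A T x] finite_I unfolding B_def by blast
  obtain l5 where l5: "bij_betw l5 I_W {B+1..H}" "inj_on (\<lambda>i. x i + l5 i) I_W"
    using ex_labels_sum_inj[of I_W B x] finite_I unfolding H_def by blast
  obtain l6 where l6: "bij_betw l6 I_both {N-q+1..N-q+q}" "inj_on (\<lambda>i. x i + l1 i + l6 i) I_both"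
    using ex_labels_sum_inj[of I_both "N-q" "\<lambda>i. x i + l1 i"] finite_I unfolding q_def by blast
  define labA where "labA a = (if a \<in> PA then l2 a else if pos a \<in> I_both then l1 (pos a)
    else if pos a \<in> I_A then l4 (pos a) else if a = sA 0 then M + q + 1 else M + q + 2)" for a
  define labW where "labW w = (if w \<in> PW then l3 w else if pos w \<in> I_W then l5 (pos w) else l6 (pos w))" for w
  define sgW where "sgW w = (if w \<in> PW then s3 w else 1)" for w
  have sgW: "sgW w \<in> {1, - 1}" for w using l3(2) by (simp add: sgW_def)
  have "\<exists>s. (\<forall>f. s f \<in> {1, - 1}) \<and> - D \<le> (\<Sum>f\<in>R_at w. s f * l0 f) \<and> (\<Sum>f\<in>R_at w. s f * l0 f) \<le> 0" for w
  proof (rule ex_signs_sum_nonpos)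
    show "0 \<le> l0 f \<and> l0 f \<le> D" if "f \<in> R_at w" for f
    proof -
      have "f \<in> R \<union> tA ` I_end" using that by (simp add: R_at_def)
      then have "l0 f \<in> {1..D}" using bij_betwE[OF l0(1)] by blast
      then show ?thesis by simp
    qed
  qed (use finite_at zone_order in auto)
  then obtain sg where sg: "\<And>w f. sg w f \<in> {1, - 1}" "\<And>w. - D \<le> (\<Sum>f\<in>R_at w. sg w f * l0 f)"
      "\<And>w. (\<Sum>f\<in>R_at w. sg w f * l0 f) \<le> 0"
    by metis
  define r where "r w = (\<Sum>f\<in>R_at w. sg w f * l0 f)" for w
  \<comment> \<open>The vertices of sign 1 take the lower block of labels for \<open>fW\<close>. If
    there are any, the others start at D + 2 or later, which is \<open>large_fW\<close>.\<close>
  define Wp where "Wp = {w \<in> W. sgW w = 1}"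
  define Wm where "Wm = {w \<in> W. sgW w \<noteq> 1}"
  have Wpm: "W = Wp \<union> Wm" "Wp \<inter> Wm = {}" "finite Wp" "finite Wm"
    using fin by (auto simp: Wp_def Wm_def)
  obtain l7 where l7: "bij_betw l7 Wp {D+1..D+int (card Wp)}" "inj_on (\<lambda>w. labW w + r w + l7 w) Wp"
    using ex_labels_sum_inj[of Wp D "\<lambda>w. labW w + r w"] Wpm by blast
  obtain l8 where l8: "bij_betw l8 Wm {D+int (card Wp)+1..D+int (card Wp)+int (card Wm)}"
      "inj_on (\<lambda>w. labW w + r w + l8 w) Wm"
    using ex_labels_sum_inj[of Wm "D+int (card Wp)" "\<lambda>w. labW w + r w"] Wpm by blast
  have cW: "M = D + int (card Wp) + int (card Wm)"
    unfolding M_def using Wpm by (simp add: card_Un_disjoint)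
  define l9 where "l9 w = (if w \<in> Wp then l7 w else l8 w)" for w
  have l9: "bij_betw l9 W {D+1..M}"
  proof -
    have "bij_betw l9 Wp {D+1..D+int (card Wp)}"
      using l7(1) by (rule bij_betw_cong[THEN iffD1, rotated]) (simp add: l9_def)
    moreover have "bij_betw l9 Wm {D+int (card Wp)+1..M}"
      unfolding cW using l8(1) by (rule bij_betw_cong[THEN iffD1, rotated]) (use Wpm in \<open>auto simp: l9_def\<close>)
    ultimately have "bij_betw l9 (Wp \<union> Wm) ({D+1..D+int (card Wp)} \<union> {D+int (card Wp)+1..M})"
      by (rule bij_betw_combine) auto
    moreover have "{D+1..D+int (card Wp)} \<union> {D+int (card Wp)+1..M} = {D+1..M}" using cW by auto
    ultimately show ?thesis using Wpm(1) by simp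
  qed
  define lab where "lab v = (if v \<in> W then labW v else if v \<in> R \<union> tA ` I_end then l0 v
    else if v \<in> F then l9 (own v) else labA v)" for v
  \<comment> \<open>On \<open>R\<close> the factor \<open>- sgW (own v)\<close> cancels the one in
    \<open>rest_sum\<close>, which becomes \<open>r w\<close>. The final 1 is the sign of the
    children left over at inner spine vertices.\<close>
  define s where "s v = (if v \<in> W then sgW v else if v \<in> R then - sgW (own v) * sg (own v) v
    else if v \<in> F then - sgW (own v) else if v \<in> PA then s2 v
    else if pos v = 0 then - 1 else if pos v = K then dir (K - 1) else 1)" for v
  have PWW: "PW \<subseteq> W" "R \<subseteq> F" "PA \<subseteq> A" "tA ` I_end \<subseteq> A" using tA(1) by (auto simp: PW_def R_def PA_def)
  have W_val: "lab w = labW w" "s w = sgW w" if "w \<in> W" for w using that by (simp_all add: lab_def s_def)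
  have R_val: "lab f = l0 f" if "f \<in> R \<union> tA ` I_end" for f
  proof -
    have "f \<notin> W" using that PWW disj by blast
    then show ?thesis using that by (simp add: lab_def)
  qed
  have R_sgn: "s f = - sgW (own f) * sg (own f) f" if "f \<in> R" for f
  proof -
    have "f \<notin> W" using that PWW disj by blast
    then show ?thesis using that by (simp add: s_def)
  qed
  have fW_val: "lab (fW w) = l9 w" "s (fW w) = - sgW w" if "w \<in> W" for w
  proof -
    have "fW w \<notin> W" "fW w \<in> F" "own (fW w) = w" using fW[OF that] disj by auto
    moreover have "fW w \<notin> R \<union> tA ` I_end" using zones_disjoint(1) that by blast
    ultimately show "lab (fW w) = l9 w" "s (fW w) = - sgW w" by (simp_all add: lab_def s_def)
  qed
  have A_val: "lab a = labA a" if "a \<in> A" "a \<notin> tA ` I_end" for a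
  proof -
    have "a \<notin> W" "a \<notin> R" "a \<notin> F" using that PWW disj by blast+
    then show ?thesis using that by (simp add: lab_def)
  qed
  have PA_val: "lab a = l2 a" "s a = s2 a" if "a \<in> PA" for a
  proof -
    have a: "a \<in> A" "a \<notin> tA ` I_end" using that by (auto simp: PA_def)
    then show "lab a = l2 a" using A_val that by (simp add: labA_def)
    have "a \<notin> W" "a \<notin> F" "a \<notin> R" using a disj PWW by blast+
    then show "s a = s2 a" using that by (simp add: s_def)
  qed
  have sA_val: "lab (sA i) = labA (sA i)" "s (sA i) = (if i = 0 then - 1 else if i = K then dir (K - 1) else 1)"
      "sA i \<notin> PA"
    if "i \<in> {0, K} \<union> I_A \<union> I_both" for i
  proof -
    have a: "sA i \<in> A" "sA i \<notin> tA ` I_end" "sA i \<notin> W" "sA i \<notin> F"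
      using sA(1)[OF that] sA_ne_tA[OF that] disj by auto
    show n: "sA i \<notin> PA" using that by (auto simp: PA_def)
    show "lab (sA i) = labA (sA i)" using A_val a by blast
    show "s (sA i) = (if i = 0 then - 1 else if i = K then dir (K - 1) else 1)"
    proof -
      have "sA i \<notin> R" using a PWW by blast
      then show ?thesis using a n sA(2)[OF that] by (simp add: s_def)
    qed
  qed
  have sA_both: "lab (sA i) = l1 i" "s (sA i) = 1" if "i \<in> I_both" for i
    using that sA_val[of i] sA(2)[of i] by (auto simp: labA_def I_defs)
  have sA_A: "lab (sA i) = l4 i" "s (sA i) = 1" if "i \<in> I_A" for i
    using that sA_val[of i] sA(2)[of i] by (auto simp: labA_def I_defs)
  have sA_ends: "lab (sA 0) = M + q + 1" "lab (sA K) = M + q + 2"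
    using sA_val[of 0] sA_val[of K] sA(2)[of 0] sA(2)[of K] sA_0_K by (auto simp: labA_def I_defs)
  have PW_val: "lab w = l3 w" "s w = s3 w" if "w \<in> PW" for w
    using that PWW W_val by (auto simp: labW_def sgW_def)
  have sW_val: "lab (sW i) = labW (sW i)" "s (sW i) = 1" "sW i \<notin> PW" if "i \<in> I_W \<union> I_both" for i
  proof -
    show n: "sW i \<notin> PW" using that by (auto simp: PW_def)
    show "lab (sW i) = labW (sW i)" "s (sW i) = 1" using W_val sW(1)[OF that] n by (simp_all add: sgW_def)
  qed
  have sW_W: "lab (sW i) = l5 i" if "i \<in> I_W" for i
    using that sW_val[of i] sW(2)[of i] by (simp add: labW_def)
  have sW_both: "lab (sW i) = l6 i" if "i \<in> I_both" for i
    using that sW_val[of i] sW(2)[of i] I_disjoint by (auto simp: labW_def)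
  have ps: "pair_sum lab s i = x i" for i
    by (simp add: pair_sum_def x_def PA_at_def PW_at_def PA_val PW_val)
  have rs: "rest_sum lab s w = r w" if "w \<in> W" for w
  proof -
    have "(\<Sum>f\<in>R_at w. s f * lab f) = (\<Sum>f\<in>R_at w. - sgW w * (sg w f * l0 f))"
      by (intro sum.cong) (auto simp: R_at_def R_val R_sgn)
    also have "\<dots> = - sgW w * r w" by (simp add: r_def sum_distrib_left)
    finally have "rest_sum lab s w = sgW w * sgW w * r w" using that by (simp add: rest_sum_def W_val)
    then show ?thesis using sgW[of w] by auto
  qed
  have "lobster_labelling K A W F pos own lab s lam dir"
  proof
    show "spine_labels K (\<lambda>i. i \<in> I_none) 1 lam dir" by (rule spine)
    show "s v \<in> {1, - 1}" if "v \<in> A \<union> W \<union> F" for v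
    proof -
      have "s v = sgW v \<or> s v = - sgW (own v) * sg (own v) v \<or> s v = - sgW (own v) \<or> s v = s2 v \<or>
          s v = - 1 \<or> s v = dir (K - 1) \<or> s v = 1"
        by (simp add: s_def)
      moreover have "- sgW (own v) * sg (own v) v \<in> {1, - 1}" "- sgW (own v) \<in> {1, - 1}"
        using sgW[of "own v"] sg(1)[of "own v" v] by auto
      ultimately show ?thesis using sgW[of v] l2(2)[of v] dir[of "K - 1"]
        by (elim disjE) (erule ssubst; (assumption | simp))+
    qed
    show "bij_betw lab (R \<union> tA ` I_end) {1..D}"
      using l0(1) by (rule bij_betw_cong[THEN iffD1, rotated]) (use R_val in simp)
    show "0 \<in> I_end \<Longrightarrow> lab (tA 0) = 1" using l0(2) by (simp add: R_val)
    show "bij_betw lab (fW ` W) {D+1..M}" using bij_betw_image_comp[OF l9 inj_fW] fW_val(1) by blast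
    show "bij_betw lab (sA ` I_both) {M+1..M+q}"
      using bij_betw_image_comp[OF l1 inj_on_subset[OF inj_sA]] sA_both(1) by blast
    show "{lab (sA 0), lab (sA K)} = {M+q+1, M+q+2}" by (simp add: sA_ends)
    show "bij_betw lab PA {M+q+2+1..T}"
      using l2(1) by (rule bij_betw_cong[THEN iffD1, rotated]) (use PA_val in simp)
    show "bij_betw lab (sA ` I_A) {T+1..B}"
      using bij_betw_image_comp[OF l4(1) inj_on_subset[OF inj_sA]] sA_A(1) by blast
    show "bij_betw lab (sW ` I_W) {B+1..H}"
      using bij_betw_image_comp[OF l5(1) inj_on_subset[OF inj_sW]] sW_W by blast
    show "bij_betw lab PW {H+1..N-q}"
      using l3(1) by (rule bij_betw_cong[THEN iffD1, rotated]) (use PW_val in simp)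
    show "bij_betw lab (sW ` I_both) {N-q+1..N}"
      using bij_betw_image_comp[OF l6(1) inj_on_subset[OF inj_sW], of lab] sW_both by simp
    show "s (sA i) = 1" if "i \<in> I_A \<union> I_both" for i using that sA_both sA_A by blast
    show "s (sW i) = 1" if "i \<in> I_W \<union> I_both" for i using that sW_val by blast
    show "s (sA 0) = - 1" "s (sA K) = dir (K - 1)" using sA_val(2)[of 0] sA_val(2)[of K] K_ge_2 by auto
    have tA_s: "s (tA i) = (if i = 0 then - 1 else if i = K then dir (K - 1) else 1)" if "i \<in> I_end" for i
    proof -
      have "tA i \<in> A" "tA i \<notin> PA" using tA[OF that] that by (auto simp: PA_def)
      moreover from this have "tA i \<notin> W" "tA i \<notin> F" "tA i \<notin> R" using disj PWW by blast+
      ultimately show ?thesis using tA(2)[OF that] by (simp add: s_def)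
    qed
    show "s (tA 0) = - 1" if "0 \<in> I_end" using tA_s[OF that] by simp
    show "s (tA K) = dir (K - 1)" if "K \<in> I_end" using tA_s[OF that] K_ge_2 by simp
    show "s (fW w) = - s w" if "w \<in> W" for w using that fW_val W_val by simp
    show "pair_sum lab s i \<in> {0, pair_sign dir i}" for i using x by (simp add: ps)
    show "- D \<le> rest_sum lab s w \<and> rest_sum lab s w \<le> 0" if "w \<in> W" for w
      using that sg(2,3)[of w] by (simp add: rs r_def)
    show "D + 2 \<le> lab (fW w)" if "w \<in> W" "s w = - 1" "w' \<in> W" "s w' = 1" for w w'
    proof -
      have "w' \<in> Wp" "w \<in> Wm" "w \<notin> Wp" using that W_val by (auto simp: Wp_def Wm_def)
      then have "1 \<le> card Wp" using Wpm by (metis One_nat_def Suc_leI card_gt_0_iff empty_iff)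
      moreover have "D + int (card Wp) + 1 \<le> l8 w" using bij_betwE[OF l8(1)] \<open>w \<in> Wm\<close> by auto
      ultimately show ?thesis using fW_val(1)[OF that(1)] \<open>w \<notin> Wp\<close> by (simp add: l9_def)
    qed
    show "w = w'" if ww: "w \<in> W" "w' \<in> W" "s w = s w'"
      "lab w + rest_sum lab s w + lab (fW w) = lab w' + rest_sum lab s w' + lab (fW w')" for w w'
    proof -
      have eq: "labW w + r w + l9 w = labW w' + r w' + l9 w'"
        using ww(4) by (simp add: W_val rs fW_val ww(1,2))
      have "(w \<in> Wp) = (w' \<in> Wp)" using ww W_val by (simp add: Wp_def)
      then consider "w \<in> Wp" "w' \<in> Wp" | "w \<in> Wm" "w' \<in> Wm" "w \<notin> Wp" "w' \<notin> Wp"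
        using ww Wpm(1) by blast
      then show ?thesis
        using eq inj_onD[OF l7(2), of w w'] inj_onD[OF l8(2), of w w'] by cases (simp_all add: l9_def)
    qed
    show "inj_on (\<lambda>i. pair_sum lab s i + lab (sA i)) I_A"
      using l4(2) by (rule inj_on_cong[THEN iffD1, rotated]) (simp add: ps sA_A)
    show "inj_on (\<lambda>i. pair_sum lab s i + lab (sW i)) I_W"
      using l5(2) by (rule inj_on_cong[THEN iffD1, rotated]) (simp add: ps sW_W)
    show "inj_on (\<lambda>i. pair_sum lab s i + lab (sA i) + lab (sW i)) I_both"
      using l6(2) by (rule inj_on_cong[THEN iffD1, rotated]) (simp add: ps sA_both sW_both)
  qed
  then show ?thesis using sA_ends(1) by blast
qed

end

subsection \<open>From labellings to orientations\<close>

context lobster_skeleton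
begin

lemma ex_far_labelling:
  "\<exists>lab s lam dir. lobster_labelling K A W F pos own lab s lam dir \<and>
    (\<forall>i. i \<in> I_none \<or> i = 0 \<longrightarrow> spine_val lab s lam dir i \<noteq> spine_val lab s lam dir K)"
proof -
  obtain lab s lam dir where l: "lobster_labelling K A W F pos own lab s lam dir" "lab (sA 0) = M + q + 1"
    using ex_labelling by blast
  interpret lobster_labelling K A W F pos own lab s lam dir by (rule l(1))
  show ?thesis using far_or_swapped[OF l(2)] swapped l(1) by blast
qed

text \<open>With \<open>u K\<close> as root, each vertex of \<open>E\<close> stands for the edge to
  its parent, so labels and orientations become functions on vertices: a vertex gains from its
  children and loses on its own edge.\<close>

lemma ex_rooted_labelling:
  assumes u: "inj_on u {..K}" "u ` {..K} \<inter> (A \<union> W \<union> F) = {}"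
    and par_u: "\<And>j. j < K \<Longrightarrow> par (u j) = u (Suc j)"
    and par_AW: "\<And>a. a \<in> A \<union> W \<Longrightarrow> par a = u (pos a)"
    and par_F: "\<And>f. f \<in> F \<Longrightarrow> par f = own f"
    and E: "E = u ` {..<K} \<union> A \<union> W \<union> F"
  shows "\<exists>lab s. bij_betw lab E {1..int (card E)} \<and> (\<forall>v. s v \<in> {1, - 1 :: int}) \<and>
    inj_on (\<lambda>v. (\<Sum>c | c \<in> E \<and> par c = v. s c * lab c) - (if v \<in> E then s v * lab v else 0)) (insert (u K) E)"
proof -
  obtain lab s lam dir where lb: "lobster_labelling K A W F pos own lab s lam dir"
    and far: "\<And>i. i \<in> I_none \<or> i = 0 \<Longrightarrow> spine_val lab s lam dir i \<noteq> spine_val lab s lam dir K"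
    using ex_far_labelling by blast
  interpret lobster_labelling K A W F pos own lab s lam dir by (rule lb)
  let ?X = "A \<union> W \<union> F"
  define ix where "ix = inv_into {..K} u"
  have ix: "ix (u j) = j" if "j \<le> K" for j using u(1) that by (simp add: ix_def)
  define l where "l v = (if v \<in> ?X then lab v else N + lam (ix v))" for v
  define t where "t v = (if v \<in> ?X then s v else dir (ix v))" for v
  have uX: "u j \<notin> ?X" if "j \<le> K" for j using u(2) that by blast
  have lu: "l (u j) = N + lam j" "t (u j) = dir j" if "j \<le> K" for j
    using uX[OF that] ix[OF that] by (simp_all add: l_def t_def)
  have lX: "l v = lab v" "t v = s v" if "v \<in> ?X" for v using that by (simp_all add: l_def t_def)
  have uinj: "u i = u j \<longleftrightarrow> i = j" if "i \<le> K" "j \<le> K" for i j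
    using inj_on_eq_iff[OF u(1)] that by simp
  have finE: "finite E" using fin by (simp add: E)
  have blX: "bij_betw l ?X {1..N}"
  proof -
    have "bij_betw lab (A \<union> F \<union> W) ({1..B} \<union> {B+1..N})"
      by (rule bij_betw_combine[OF lab_A_F lab_W_all]) auto
    moreover have "{1..B} \<union> {B+1..N} = {1..N}" using zone_order by auto
    moreover have "A \<union> F \<union> W = ?X" by blast
    ultimately have "bij_betw lab ?X {1..N}" by simp
    then show ?thesis by (rule bij_betw_cong[THEN iffD1, rotated]) (simp add: lX)
  qed
  have blu: "bij_betw l (u ` {..<K}) {N+1..N+int K}"
  proof (rule bij_betw_image_comp)
    have "bij_betw lam {..<K} {1..int K}" using spine by (simp add: spine_labels_def)
    moreover have "bij_betw (\<lambda>x. N + x) {1..int K} {N+1..N+int K}"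
      by (rule bij_betwI[where g = "\<lambda>x. x - N"]) auto
    ultimately show "bij_betw ((\<lambda>x. N + x) \<circ> lam) {..<K} {N+1..N+int K}" by (rule bij_betw_trans)
    show "inj_on u {..<K}" using u(1) by (rule inj_on_subset) auto
  qed (simp add: lu)
  have bl: "bij_betw l E {1..int (card E)}"
  proof -
    have "bij_betw l (?X \<union> u ` {..<K}) ({1..N} \<union> {N+1..N+int K})"
      by (rule bij_betw_combine[OF blX blu]) auto
    moreover have "{1..N} \<union> {N+1..N+int K} = {1..N+int K}" using zone_order by auto
    moreover have "?X \<union> u ` {..<K} = E" by (auto simp: E)
    ultimately have b: "bij_betw l E {1..N+int K}" by simp
    then have "card E = nat (N + int K)" using bij_betw_same_card[OF b] by simp
    moreover have "0 \<le> N" using zone_order by linarith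
    ultimately show ?thesis using b by simp
  qed
  define val where "val v = (\<Sum>c | c \<in> E \<and> par c = v. t c * l c) - (if v \<in> E then t v * l v else 0)" for v
  have ownW: "own f \<in> W" if "f \<in> F" for f using own_F that .
  have posK: "pos a \<le> K" if "a \<in> A \<union> W" for a using that pos_A pos_W by (force intro: less_imp_le)
  have uW: "u j \<notin> W" if "j \<le> K" for j using uX[OF that] by blast
  have val_u: "val (u i) = sval i" if i: "i \<le> K" for i
  proof -
    have ch: "{c. c \<in> E \<and> par c = u i} = (if i = 0 then {} else {u (i - 1)}) \<union> (A_at i \<union> W_at i)" (is "?L = ?R")
    proof
      show "?L \<subseteq> ?R"
      proof
        fix c assume "c \<in> ?L"
        then have c: "c \<in> E" "par c = u i" by auto
        consider j where "j < K" "c = u j" | "c \<in> A \<union> W" | "c \<in> F" using c(1) unfolding E by blast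
        then show "c \<in> ?R"
        proof cases
          case 1
          then have "u (Suc j) = u i" using c par_u by simp
          then have "Suc j = i" using uinj[of "Suc j" i] 1 i by simp
          then show ?thesis using 1 by auto
        next
          case 2
          then have "pos c = i" using c par_AW[OF 2] uinj[of "pos c" i] posK[OF 2] i by simp
          then show ?thesis using 2 by (auto simp: A_at_def W_at_def)
        next
          case 3
          then show ?thesis using c par_F ownW uW[OF i] by metis
        qed
      qed
      show "?R \<subseteq> ?L"
      proof
        fix c assume "c \<in> ?R"
        then consider "i \<noteq> 0" "c = u (i - 1)" | "c \<in> A \<union> W" "pos c = i"
          by (auto simp: A_at_def W_at_def split: if_splits)
        then show "c \<in> ?L"
        proof cases
          case 1
          then have "i - 1 < K" "Suc (i - 1) = i" using i by auto
          then show ?thesis using 1 par_u[of "i - 1"] by (auto simp: E)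
        next
          case 2
          then show ?thesis using par_AW by (auto simp: E)
        qed
      qed
    qed
    have d1: "(if i = 0 then {} else {u (i - 1)}) \<inter> (A_at i \<union> W_at i) = {}"
      using uX[of "i - 1"] i by (auto simp: A_at_def W_at_def)
    have d2: "A_at i \<inter> W_at i = {}" using disj by (auto simp: A_at_def W_at_def)
    have "(\<Sum>c | c \<in> E \<and> par c = u i. t c * l c) = (if i = 0 then 0 else t (u (i - 1)) * l (u (i - 1))) +
        ((\<Sum>c\<in>A_at i. t c * l c) + (\<Sum>c\<in>W_at i. t c * l c))"
      unfolding ch using d1 d2 finite_at by (subst sum.union_disjoint; (simp add: sum.union_disjoint)?)+
    also have "(\<Sum>c\<in>A_at i. t c * l c) = (\<Sum>c\<in>A_at i. s c * lab c)"
      by (intro sum.cong) (auto simp: A_at_def lX)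
    also have "(\<Sum>c\<in>W_at i. t c * l c) = (\<Sum>c\<in>W_at i. s c * lab c)"
      by (intro sum.cong) (auto simp: W_at_def lX)
    finally have e: "(\<Sum>c | c \<in> E \<and> par c = u i. t c * l c) = (if i = 0 then 0 else t (u (i - 1)) * l (u (i - 1))) +
        ((\<Sum>c\<in>A_at i. s c * lab c) + (\<Sum>c\<in>W_at i. s c * lab c))" .
    have uE: "u i \<in> E \<longleftrightarrow> i < K"
    proof
      assume "u i \<in> E"
      then obtain j where "j < K" "u i = u j" using uX[OF i] unfolding E by blast
      then show "i < K" using uinj[of i j] i by simp
    qed (simp add: E)
    show ?thesis unfolding val_def e using uE i lu[of i] lu[of "i - 1"]
      by (auto simp: spine_val_def)
  qed
  have val_X: "val v = nval v" if v: "v \<in> ?X" for v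
  proof -
    have "{c. c \<in> E \<and> par c = v} = {f. f \<in> F \<and> own f = v}"
    proof
      show "{c. c \<in> E \<and> par c = v} \<subseteq> {f. f \<in> F \<and> own f = v}"
      proof
        fix c assume "c \<in> {c. c \<in> E \<and> par c = v}"
        then have c: "c \<in> E" "par c = v" by auto
        have "c \<notin> u ` {..<K}" using c par_u uX v by (metis Suc_leI imageE lessThan_iff)
        moreover have "c \<notin> A \<union> W" using c par_AW uX posK v by metis
        ultimately show "c \<in> {f. f \<in> F \<and> own f = v}" using c par_F unfolding E by auto
      qed
      show "{f. f \<in> F \<and> own f = v} \<subseteq> {c. c \<in> E \<and> par c = v}" using par_F by (auto simp: E)
    qed
    moreover have "(\<Sum>f | f \<in> F \<and> own f = v. t f * l f) = (\<Sum>f | f \<in> F \<and> own f = v. s f * lab f)"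
      by (intro sum.cong) (auto simp: lX)
    moreover have "v \<in> E" using v by (auto simp: E)
    ultimately show ?thesis using lX[OF v] by (simp add: val_def node_val_def)
  qed
  have V: "insert (u K) E = u ` {..K} \<union> ?X" by (auto simp: E lessThan_Suc_atMost[symmetric] lessThan_Suc)
  have "inj_on val (u ` {..K} \<union> ?X)"
  proof (rule inj_onI)
    fix v w assume v: "v \<in> u ` {..K} \<union> ?X" and w: "w \<in> u ` {..K} \<union> ?X" and eq: "val v = val w"
    have si: "inj_on sval {..K}" using far by (rule inj_sval)
    consider i j where "i \<le> K" "j \<le> K" "v = u i" "w = u j" | i where "i \<le> K" "v = u i" "w \<in> ?X"
      | j where "j \<le> K" "w = u j" "v \<in> ?X" | "v \<in> ?X" "w \<in> ?X"
      using v w by blast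
    then show "v = w"
    proof cases
      case 1
      then have "sval i = sval j" using eq val_u by simp
      then show ?thesis using inj_onD[OF si, of i j] 1 by simp
    next
      case 2
      then have "sval i = nval w" using eq val_u val_X by simp
      then show ?thesis using sval_neq_nval 2 by blast
    next
      case 3
      then have "sval j = nval v" using eq val_u val_X by simp
      then show ?thesis using sval_neq_nval 3 by blast
    next
      case 4
      then have "nval v = nval w" using eq val_X by simp
      then show ?thesis using inj_onD[OF inj_nval] 4 by blast
    qed
  qed
  then have iv: "inj_on val (insert (u K) E)" unfolding V .
  have "t v \<in> {1, - 1}" for v using sgn[of v] dir(1)[of "ix v"] unfolding t_def by presburger
  then show ?thesis using bl iv[unfolded val_def] by blast
qed

end

text \<open>\<open>no2\<close> prevents two vertices of \<open>E\<close> from standing for the same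
  edge, so \<open>E\<close> counts the edges. Sign 1 orients the edge from \<open>v\<close> to
  \<open>par v\<close>.\<close>

lemma ex_antimagic_orientation_rooted:
  fixes G :: "('a, 'b) pre_digraph" and lab s :: "'a \<Rightarrow> int"
  assumes G: "graph G" and E: "E \<subseteq> verts G"
    and ends: "arcs_ends G = (\<lambda>v. (v, par v)) ` E \<union> (\<lambda>v. (par v, v)) ` E"
    and no2: "\<And>v. v \<in> E \<Longrightarrow> par v \<in> E \<Longrightarrow> par (par v) \<noteq> v"
    and lab: "bij_betw lab E {1..int (card E)}" and s: "\<And>v. s v \<in> {1, - 1}"
    and inj: "inj_on (\<lambda>v. (\<Sum>c | c \<in> E \<and> par c = v. s c * lab c) - (if v \<in> E then s v * lab v else 0)) (verts G)"
  shows "\<exists>D \<tau>. antimagic_orientation G D \<tau>"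
proof -
  interpret graph G by (rule G)
  have finE: "finite E" using E finite_verts by (rule finite_subset)
  define tl where "tl v = (if s v = 1 then v else par v)" for v
  define hd where "hd v = (if s v = 1 then par v else v)" for v
  have "\<exists>e. e \<in> arcs G \<and> tail G e = tl v \<and> head G e = hd v" if "v \<in> E" for v
  proof -
    have "(tl v, hd v) \<in> arcs_ends G" using that by (auto simp: ends tl_def hd_def)
    then show ?thesis by (auto simp: arcs_ends_conv)
  qed
  then obtain \<alpha> where \<alpha>: "\<And>v. v \<in> E \<Longrightarrow> \<alpha> v \<in> arcs G \<and> tail G (\<alpha> v) = tl v \<and> head G (\<alpha> v) = hd v"
    by metis
  have pair_eq: "v = w" if "v \<in> E" "w \<in> E" "tl v = tl w" "hd v = hd w" for v w
    using that no2[of v] no2[of w] by (auto simp: tl_def hd_def split: if_splits)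
  have ne: "par v \<noteq> v" if "v \<in> E" for v
  proof -
    have "(v, par v) \<in> arcs_ends G" using that by (auto simp: ends)
    then show ?thesis using adj_not_same by metis
  qed
  have pair_opp: False if "v \<in> E" "w \<in> E" "tl v = hd w" "hd v = tl w" for v w
  proof -
    show False using that no2[of v] no2[of w] ne[of v] ne[of w] by (auto simp: tl_def hd_def split: if_splits)
  qed
  have inj_\<alpha>: "inj_on \<alpha> E" using \<alpha> pair_eq by (metis inj_onI)
  define D where "D = G\<lparr>arcs := \<alpha> ` E\<rparr>"
  define \<tau> where "\<tau> e = nat (lab (inv_into E \<alpha> e))" for e
  have lab_pos: "1 \<le> lab v" if "v \<in> E" for v using bij_betwE[OF lab] that by auto
  have \<tau>: "int (\<tau> (\<alpha> v)) = lab v" if "v \<in> E" for v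
    using lab_pos[OF that] inj_\<alpha> that by (simp add: \<tau>_def)
  have D: "verts D = verts G" "arcs D = \<alpha> ` E" "tail D = tail G" "head D = head G"
    by (simp_all add: D_def)
  have aD: "\<alpha> ` E \<subseteq> arcs G" using \<alpha> by blast
  have "wf_digraph D" using aD by unfold_locales (auto simp: D)
  then have "spanning D G"
    unfolding spanning_def subgraph_def compatible_def using D aD wf_digraph by auto
  have endsD: "arcs_ends D = (\<lambda>v. (tl v, hd v)) ` E"
    using \<alpha> by (auto simp: arcs_ends_conv D image_image intro!: image_cong)
  have or: "((x, y) \<in> arcs_ends D) \<noteq> ((y, x) \<in> arcs_ends D)" if xy: "(x, y) \<in> arcs_ends G" for x y
  proof -
    obtain v where v: "v \<in> E" "(x, y) = (v, par v) \<or> (x, y) = (par v, v)" using xy unfolding ends by blast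
    then have "(x, y) = (tl v, hd v) \<or> (y, x) = (tl v, hd v)" by (auto simp: tl_def hd_def)
    then have "(x, y) \<in> arcs_ends D \<or> (y, x) \<in> arcs_ends D" using v(1) by (auto simp: endsD)
    moreover have "\<not> ((x, y) \<in> arcs_ends D \<and> (y, x) \<in> arcs_ends D)"
      using pair_opp by (auto simp: endsD)
    ultimately show ?thesis by blast
  qed
  have orient: "orientation G D" unfolding orientation_def using \<open>spanning D G\<close> or by auto
  have "undirected_edges G = (\<lambda>v. {v, par v}) ` E"
    by (auto simp: undirected_edges_def ends image_Un image_image insert_commute)
  moreover have "inj_on (\<lambda>v. {v, par v}) E"
    using no2 ne by (auto simp: inj_on_def doubleton_eq_iff)
  ultimately have cE: "card (undirected_edges G) = card E" by (simp add: card_image)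
  have bij: "bij_betw \<tau> (arcs D) {1..card (undirected_edges G)}"
  proof -
    have "bij_betw nat {1..int (card E)} {1..card E}"
      by (rule bij_betwI[where g = int]) auto
    with lab have "bij_betw (nat \<circ> lab) E {1..card E}" by (rule bij_betw_trans)
    then have "bij_betw \<tau> (\<alpha> ` E) {1..card E}"
      by (rule bij_betw_image_comp[OF _ inj_\<alpha>]) (simp add: \<tau>_def inj_\<alpha>)
    then show ?thesis by (simp add: cE D)
  qed
  have vs: "vertex_sum D \<tau> x = (\<Sum>c | c \<in> E \<and> par c = x. s c * lab c) - (if x \<in> E then s x * lab x else 0)" for x
  proof -
    have sub: "(\<Sum>e | e \<in> \<alpha> ` E \<and> g e = x. int (\<tau> e)) = (\<Sum>v\<in>E. if g (\<alpha> v) = x then lab v else 0)" for g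
    proof -
      have "(\<Sum>e | e \<in> \<alpha> ` E \<and> g e = x. int (\<tau> e)) = (\<Sum>e\<in>\<alpha> ` E. if g e = x then int (\<tau> e) else 0)"
        using finE by (simp add: sum.inter_filter)
      also have "\<dots> = (\<Sum>v\<in>E. if g (\<alpha> v) = x then lab v else 0)"
        by (simp add: sum.reindex[OF inj_\<alpha>] \<tau> cong: sum.cong if_cong)
      finally show ?thesis .
    qed
    have "vertex_sum D \<tau> x = (\<Sum>v\<in>E. if head G (\<alpha> v) = x then lab v else 0) - (\<Sum>v\<in>E. if tail G (\<alpha> v) = x then lab v else 0)"
      unfolding vertex_sum_def in_arcs_def out_arcs_def D by (simp only: sub)
    also have "\<dots> = (\<Sum>v\<in>E. (if head G (\<alpha> v) = x then lab v else 0) - (if tail G (\<alpha> v) = x then lab v else 0))"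
      by (simp add: sum_subtractf)
    \<comment> \<open>For either sign, the arc of \<open>v\<close> contributes
      \<open>s v * lab v\<close> at \<open>par v\<close> and the negative of it at
      \<open>v\<close>.\<close>
    also have "\<dots> = (\<Sum>v\<in>E. (if par v = x then s v * lab v else 0) - (if v = x then s v * lab v else 0))"
    proof (rule sum.cong[OF refl])
      fix v assume "v \<in> E"
      then show "(if head G (\<alpha> v) = x then lab v else 0) - (if tail G (\<alpha> v) = x then lab v else 0) =
          (if par v = x then s v * lab v else 0) - (if v = x then s v * lab v else 0)"
        using \<alpha>[of v] s[of v] by (auto simp: tl_def hd_def)
    qed
    also have "\<dots> = (\<Sum>v\<in>E. if par v = x then s v * lab v else 0) - (\<Sum>v\<in>E. if v = x then s v * lab v else 0)"
      by (simp add: sum_subtractf)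
    also have "(\<Sum>v\<in>E. if v = x then s v * lab v else 0) = (if x \<in> E then s x * lab x else 0)"
      using finE by (simp add: sum.delta)
    also have "(\<Sum>v\<in>E. if par v = x then s v * lab v else 0) = (\<Sum>c | c \<in> E \<and> par c = x. s c * lab c)"
      using finE by (simp add: sum.inter_filter)
    finally show ?thesis .
  qed
  have "inj_on (vertex_sum D \<tau>) (verts D)"
    unfolding D(1) using inj by (rule inj_on_cong[THEN iffD1, rotated]) (simp add: vs)
  then show ?thesis unfolding antimagic_orientation_def using orient bij by blast
qed

subsection \<open>Lobsters\<close>

lemma (in nomulti_digraph) out_degree_eq_card_successors:
  "out_degree G v = card {w. (v, w) \<in> arcs_ends G}"
proof -
  have "{w. (v, w) \<in> arcs_ends G} = head G ` out_arcs G v"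
    by (auto simp: arcs_ends_conv out_arcs_def)
  moreover have "inj_on (head G) (out_arcs G v)"
    using no_multi_arcs by (auto simp: inj_on_def arc_to_ends_def)
  ultimately show ?thesis by (simp add: out_degree_def card_image)
qed

lemma arcs_ends_remove_leaves:
  "(v, w) \<in> arcs_ends (remove_leaves G) \<longleftrightarrow>
    (v, w) \<in> arcs_ends G \<and> v \<in> verts G - leaves G \<and> w \<in> verts G - leaves G"
  by (auto simp: remove_leaves_def arcs_ends_conv image_iff)

lemma verts_remove_leaves: "verts (remove_leaves G) = verts G - leaves G"
  by (simp add: remove_leaves_def)

lemma adjacent_leaves:
  assumes "connected G" "x \<in> verts G" "{w. (x, w) \<in> arcs_ends G} = {y}" "{w. (y, w) \<in> arcs_ends G} = {x}"
    "symmetric G"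
  shows "verts G \<subseteq> {x, y}"
proof
  fix v assume "v \<in> verts G"
  then have "(x, v) \<in> rtrancl_on (verts G) ((arcs_ends G)\<^sup>s)"
    using assms(1,2) by (simp add: connected_conv)
  then show "v \<in> {x, y}"
  proof (induction rule: rtrancl_on_induct)
    case (step u v)
    then have "(u, v) \<in> arcs_ends G"
      using assms(5) arcs_ends_symmetric[OF assms(5)] by (auto simp: symcl_def)
    then show ?case using step.IH assms(3,4) by blast
  qed simp
qed

text \<open>Two adjacent leaves would form a whole component, and a connected graph on three
  vertices has none of that kind.\<close>

lemma tree_leaf_neighbour:
  assumes "undirected_tree G" "3 \<le> card (verts G)" "v \<in> leaves G"
  obtains w where "w \<in> verts G - leaves G" "{x. (v, x) \<in> arcs_ends G} = {w}"
proof -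
  interpret graph G using assms(1) by (simp add: undirected_tree_def)
  have "card {w. (v, w) \<in> arcs_ends G} = 1"
    using assms(3) by (simp add: leaves_def out_degree_eq_card_successors)
  then obtain w where w: "{x. (v, x) \<in> arcs_ends G} = {w}" by (auto simp: card_1_singleton_iff)
  then have vw: "(v, w) \<in> arcs_ends G" by blast
  have wv: "(w, v) \<in> arcs_ends G" using vw sym_arcs by (rule arcs_ends_symmetric[rotated])
  have "w \<notin> leaves G"
  proof
    assume "w \<in> leaves G"
    then have "card {x. (w, x) \<in> arcs_ends G} = 1" by (simp add: leaves_def out_degree_eq_card_successors)
    then obtain y where y: "{x. (w, x) \<in> arcs_ends G} = {y}" by (auto simp: card_1_singleton_iff)
    moreover have "v \<in> {x. (w, x) \<in> arcs_ends G}" using wv by simp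
    ultimately have y: "{x. (w, x) \<in> arcs_ends G} = {v}" by simp
    have "verts G \<subseteq> {v, w}"
    proof (rule adjacent_leaves[OF _ _ w y sym_arcs])
      show "connected G" using assms(1) unfolding undirected_tree_def by blast
      show "v \<in> verts G" using assms(3) unfolding leaves_def by blast
    qed
    then have "card (verts G) \<le> card {v, w}" by (intro card_mono) auto
    also have "\<dots> \<le> 2" by (simp add: card_insert_if)
    finally show False using assms(2) by simp
  qed
  moreover have "w \<in> verts G" using adj_in_verts[OF vw] by simp
  ultimately show ?thesis using that w by blast
qed

section \<open>The path inside a caterpillar and its ends\<close>

lemma path_graph_edges:
  assumes "path_graph P"
  obtains vs where "vs \<noteq> []" "distinct vs" "set vs = verts P"
    "\<And>x y. (x, y) \<in> arcs_ends P \<longleftrightarrow> (\<exists>i. Suc i < length vs \<and> {x, y} = {vs ! i, vs ! Suc i})"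
proof -
  interpret graph P using assms by (simp add: path_graph_def)
  obtain vs where vs: "vs \<noteq> []" "distinct vs" "set vs = verts P"
    "undirected_edges P = {{vs ! i, vs ! Suc i} | i. Suc i < length vs}"
    using assms by (auto simp: path_graph_def)
  have "(x, y) \<in> arcs_ends P \<longleftrightarrow> {x, y} \<in> undirected_edges P" for x y
    using arcs_ends_symmetric[OF sym_arcs] by (auto simp: undirected_edges_def doubleton_eq_iff)
  then have "(x, y) \<in> arcs_ends P \<longleftrightarrow> (\<exists>i. Suc i < length vs \<and> {x, y} = {vs ! i, vs ! Suc i})" for x y
    unfolding vs(4) by blast
  then show ?thesis using that vs(1-3) by blast
qed

text \<open>Supplies the two extra vertices of the spine. An end of the path has one neighbour on it
  but is no leaf of \<open>C\<close>, so a leaf of \<open>C\<close> hangs there; the two leaves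
  differ because a leaf has only one neighbour. If the path is a single vertex, \<open>C\<close> is
  a star and has two leaves to offer.\<close>

lemma caterpillar_ends:
  assumes "caterpillar C" and vs: "vs \<noteq> []" "distinct vs" "set vs = verts C - leaves C"
    and adj: "\<And>x y. (x, y) \<in> arcs_ends (remove_leaves C) \<longleftrightarrow>
      (\<exists>i. Suc i < length vs \<and> {x, y} = {vs ! i, vs ! Suc i})"
  obtains w w' where "w \<in> leaves C" "w' \<in> leaves C" "w \<noteq> w'"
    "(w, vs ! 0) \<in> arcs_ends C" "(w', vs ! (length vs - 1)) \<in> arcs_ends C"
proof -
  have tree: "undirected_tree C" "3 \<le> card (verts C)" using assms(1) by (simp_all add: caterpillar_def)
  interpret graph C using tree by (simp add: undirected_tree_def)
  have sym: "(x, y) \<in> arcs_ends C \<Longrightarrow> (y, x) \<in> arcs_ends C" for x y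
    by (rule arcs_ends_symmetric[OF sym_arcs])
  let ?k = "length vs"
  have k: "0 < ?k" using vs(1) by simp
  show ?thesis
  proof (cases "?k = 1")
    case True
    then have one: "verts C - leaves C = {vs ! 0}" using vs(3) by (cases vs) auto
    have "leaves C \<subseteq> verts C" by (auto simp: leaves_def)
    then have "verts C = insert (vs ! 0) (leaves C)" using one by blast
    moreover have fL: "finite (leaves C)" by (simp add: leaves_def)
    ultimately have "2 \<le> card (leaves C)" using tree(2) by (simp add: card_insert_if split: if_splits)
    then obtain w w' where w: "w \<in> leaves C" "w' \<in> leaves C" "w \<noteq> w'"
      using card_le_Suc0_iff_eq[OF fL] by (auto simp: not_less_eq_eq numeral_2_eq_2)
    have "(w, vs ! 0) \<in> arcs_ends C" if w: "w \<in> leaves C" for w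
    proof -
      obtain x where x: "x \<in> verts C - leaves C" "{y. (w, y) \<in> arcs_ends C} = {x}"
        using tree w by (rule tree_leaf_neighbour)
      then have "x \<in> {y. (w, y) \<in> arcs_ends C}" "x = vs ! 0" using one by simp_all
      then show ?thesis by simp
    qed
    then show ?thesis using that[OF w] w True by simp
  next
    case False
    then have k2: "2 \<le> ?k" "Suc (?k - 2) = ?k - 1" "Suc (?k - 2) < ?k" using k by linarith+
    have other: "\<exists>w. w \<in> leaves C \<and> (w, v) \<in> arcs_ends C"
      if v: "v \<in> verts C - leaves C" and v': "{y. (v, y) \<in> arcs_ends (remove_leaves C)} = {v'}" for v v'
    proof -
      have "card {y. (v, y) \<in> arcs_ends C} \<noteq> 1"
        using v by (simp add: leaves_def out_degree_eq_card_successors)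
      moreover have "(v, v') \<in> arcs_ends C" using v' by (auto simp: arcs_ends_remove_leaves)
      ultimately have "{y. (v, y) \<in> arcs_ends C} \<noteq> {v'}" "v' \<in> {y. (v, y) \<in> arcs_ends C}" by auto
      then obtain y where y: "(v, y) \<in> arcs_ends C" "y \<noteq> v'" by blast
      then have "(v, y) \<notin> arcs_ends (remove_leaves C)" using v' by blast
      moreover have "y \<in> verts C" using adj_in_verts[OF y(1)] by simp
      ultimately have "y \<in> leaves C" using y v by (simp add: arcs_ends_remove_leaves)
      then show ?thesis using y(1) sym by blast
    qed
    have nth_eq: "vs ! i = vs ! j \<longleftrightarrow> i = j" if "i < ?k" "j < ?k" for i j
      using vs(2) that by (rule nth_eq_iff_index_eq)
    have "{y. (vs ! 0, y) \<in> arcs_ends (remove_leaves C)} = {vs ! 1}"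
    proof -
      have "y = vs ! 1" if y: "(vs ! 0, y) \<in> arcs_ends (remove_leaves C)" for y
      proof -
        obtain i where i: "Suc i < ?k" "{vs ! 0, y} = {vs ! i, vs ! Suc i}" using y adj by blast
        then show ?thesis using nth_eq[of 0 i] nth_eq[of 0 "Suc i"] k by (auto simp: doubleton_eq_iff)
      qed
      moreover have "(vs ! 0, vs ! 1) \<in> arcs_ends (remove_leaves C)"
        unfolding adj using k2 by (intro exI[of _ 0]) simp
      ultimately show ?thesis by blast
    qed
    moreover have "vs ! 0 \<in> verts C - leaves C" using vs(3) k by (metis nth_mem)
    ultimately obtain w where w: "w \<in> leaves C" "(w, vs ! 0) \<in> arcs_ends C" using other by blast
    have "{y. (vs ! (?k - 1), y) \<in> arcs_ends (remove_leaves C)} = {vs ! (?k - 2)}"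
    proof -
      have "y = vs ! (?k - 2)" if y: "(vs ! (?k - 1), y) \<in> arcs_ends (remove_leaves C)" for y
      proof -
        obtain i where i: "Suc i < ?k" "{vs ! (?k - 1), y} = {vs ! i, vs ! Suc i}" using y adj by blast
        then have "vs ! (?k - 1) \<noteq> vs ! i" using nth_eq[of "?k - 1" i] k by auto
        then have "vs ! (?k - 1) = vs ! Suc i" "y = vs ! i" using i(2) by (auto simp: doubleton_eq_iff)
        moreover from this have "i = ?k - 2" using nth_eq[of "?k - 1" "Suc i"] i(1) k by simp
        ultimately show ?thesis by simp
      qed
      moreover have "(vs ! (?k - 1), vs ! (?k - 2)) \<in> arcs_ends (remove_leaves C)"
        unfolding adj using k2 by (intro exI[of _ "?k - 2"]) (simp only: insert_commute simp_thms)
      ultimately show ?thesis by blast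
    qed
    moreover have "vs ! (?k - 1) \<in> verts C - leaves C" using vs(3) k by (metis nth_mem diff_less zero_less_one)
    ultimately obtain w' where w': "w' \<in> leaves C" "(w', vs ! (?k - 1)) \<in> arcs_ends C" using other by blast
    have "w \<noteq> w'"
    proof
      assume "w = w'"
      moreover obtain x where "{y. (w, y) \<in> arcs_ends C} = {x}"
        using tree w(1) by (rule tree_leaf_neighbour)
      moreover from calculation have "vs ! 0 \<in> {x}" using w(2) by (metis mem_Collect_eq)
      moreover from calculation have "vs ! (?k - 1) \<in> {x}" using w'(2) by (metis mem_Collect_eq)
      ultimately have "vs ! 0 = vs ! (?k - 1)" by simp
      then show False using nth_eq[of 0 "?k - 1"] False k by simp
    qed
    then show ?thesis using that w w' by blast
  qed
qed

theorem theorem1: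
  fixes G :: "('a, 'b) pre_digraph"
  assumes "lobster G"
  shows "\<exists>D \<tau>. antimagic_orientation G D \<tau>"
proof -
  define C where "C = remove_leaves G"
  have treeG: "undirected_tree G" and cat: "caterpillar C"
    using assms by (simp_all add: lobster_def C_def)
  have treeC: "undirected_tree C" "3 \<le> card (verts C)" and path: "path_graph (remove_leaves C)"
    using cat by (simp_all add: caterpillar_def)
  have gr: "graph G" using treeG by (simp add: undirected_tree_def)
  interpret graph G by (rule gr)
  have sym: "(x, y) \<in> arcs_ends G \<Longrightarrow> (y, x) \<in> arcs_ends G" for x y
    by (rule arcs_ends_symmetric[OF sym_arcs])
  have vC: "verts C = verts G - leaves G" by (simp add: C_def verts_remove_leaves)
  have eC: "(x, y) \<in> arcs_ends C \<longleftrightarrow> (x, y) \<in> arcs_ends G \<and> x \<in> verts C \<and> y \<in> verts C" for x y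
    by (simp add: C_def arcs_ends_remove_leaves verts_remove_leaves)
  have lv: "leaves G \<subseteq> verts G" "leaves C \<subseteq> verts C" by (auto simp: leaves_def)
  have "card (verts C) \<le> card (verts G)" unfolding vC by (intro card_mono) auto
  then have cG: "3 \<le> card (verts G)" using treeC by simp
  have "\<exists>w. w \<in> verts C \<and> {x. (v, x) \<in> arcs_ends G} = {w}" if "v \<in> leaves G" for v
    using tree_leaf_neighbour[OF treeG cG that] vC by metis
  then obtain p where p: "\<And>v. v \<in> leaves G \<Longrightarrow> p v \<in> verts C \<and> {x. (v, x) \<in> arcs_ends G} = {p v}"
    by metis
  have "\<exists>w. w \<in> verts C - leaves C \<and> {x. (v, x) \<in> arcs_ends C} = {w}" if "v \<in> leaves C" for v
    using tree_leaf_neighbour[OF treeC that] by metis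
  then obtain pC where pC: "\<And>v. v \<in> leaves C \<Longrightarrow> pC v \<in> verts C - leaves C \<and> {x. (v, x) \<in> arcs_ends C} = {pC v}"
    by metis
  have p_iff: "(v, x) \<in> arcs_ends G \<longleftrightarrow> x = p v" if "v \<in> leaves G" for v x using p[OF that] by blast
  have pC_iff: "(v, x) \<in> arcs_ends C \<longleftrightarrow> x = pC v" if "v \<in> leaves C" for v x using pC[OF that] by blast
  obtain vs where vs: "vs \<noteq> []" "distinct vs" "set vs = verts C - leaves C"
    and adj: "\<And>x y. (x, y) \<in> arcs_ends (remove_leaves C) \<longleftrightarrow> (\<exists>i. Suc i < length vs \<and> {x, y} = {vs ! i, vs ! Suc i})"
    using path_graph_edges[OF path] unfolding verts_remove_leaves by blast
  let ?k = "length vs"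
  have k: "0 < ?k" using vs(1) by simp
  obtain w0 w1 where w01: "w0 \<in> leaves C" "w1 \<in> leaves C" "w0 \<noteq> w1"
    "(w0, vs ! 0) \<in> arcs_ends C" "(w1, vs ! (?k - 1)) \<in> arcs_ends C"
    using cat vs adj by (rule caterpillar_ends)
  have pC01: "pC w0 = vs ! 0" "pC w1 = vs ! (?k - 1)" using w01 pC_iff by simp_all
  \<comment> \<open>The path together with \<open>w0\<close> and \<open>w1\<close> has
    \<open>?k + 2\<close> vertices, numbered 0..K.\<close>
  define K where "K = Suc ?k"
  define u where "u i = (if i = 0 then w0 else if i \<le> ?k then vs ! (i - 1) else w1)" for i
  \<comment> \<open>The new ends count as spine, so the leaves of \<open>G\<close> at
    \<open>w0\<close> and \<open>w1\<close> belong to \<open>A\<close> and provide the leaves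
    required at both ends.\<close>
  define W where "W = leaves C - {w0, w1}"
  define A where "A = {a \<in> leaves G. p a \<notin> W}"
  define F where "F = {f \<in> leaves G. p f \<in> W}"
  define ix where "ix = inv_into {..K} u"
  define pos where "pos v = (if v \<in> leaves G then ix (p v) else ix (pC v))" for v
  define par where "par v = (if v \<in> leaves G then p v else if v \<in> W then pC v else u (Suc (ix v)))" for v
  define E where "E = u ` {..<K} \<union> A \<union> W \<union> F"
  have u_mid: "u (Suc i) = vs ! i" if "i < ?k" for i using that by (simp add: u_def)
  have u_ends: "u 0 = w0" "u K = w1" by (simp_all add: u_def K_def)
  have u_in: "u i \<in> set vs" if "0 < i" "i < K" for i
    using that by (auto simp: u_def K_def)
  have u_img: "u ` {..K} = insert w0 (insert w1 (set vs))"
  proof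
    show "u ` {..K} \<subseteq> insert w0 (insert w1 (set vs))" by (auto simp: u_def K_def)
    have "x \<in> u ` {..K}" if x: "x \<in> set vs" for x
    proof -
      obtain i where "i < ?k" "x = vs ! i" using x by (auto simp: in_set_conv_nth)
      then show ?thesis using u_mid[of i] by (intro image_eqI[of _ _ "Suc i"]) (simp_all add: K_def)
    qed
    moreover have "w0 \<in> u ` {..K}" "w1 \<in> u ` {..K}" using u_ends by (metis atMost_iff imageI le0 order_refl)+
    ultimately show "insert w0 (insert w1 (set vs)) \<subseteq> u ` {..K}" by blast
  qed
  have wvs: "w0 \<notin> set vs" "w1 \<notin> set vs" using w01 vs(3) by auto
  have inj: "inj_on u {..K}"
  proof (rule eq_card_imp_inj_on)
    show "card (u ` {..K}) = card {..K}"
      unfolding u_img using wvs w01(3) distinct_card[OF vs(2)] by (simp add: K_def)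
  qed simp
  have ix: "ix (u i) = i" if "i \<le> K" for i using inj that by (simp add: ix_def)
  have u_ix: "u (ix x) = x" "ix x \<le> K" if "x \<in> u ` {..K}" for x
    using f_inv_into_f[OF that] inv_into_into[OF that] by (simp_all add: ix_def)
  have u_C: "u ` {..K} \<subseteq> verts C" "u ` {..K} \<inter> W = {}"
    unfolding u_img W_def using vs(3) w01 lv by auto
  have W_C: "W \<subseteq> verts C" "W \<subseteq> leaves C" using lv by (auto simp: W_def)
  have AF: "A \<subseteq> leaves G" "F \<subseteq> leaves G" "A \<union> F = leaves G" "A \<inter> F = {}" by (auto simp: A_def F_def)
  have CL: "verts C \<inter> leaves G = {}" by (auto simp: vC)
  have C_eq: "verts C = u ` {..K} \<union> W" unfolding u_img W_def using vs(3) w01 lv by auto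
  have pA: "p a \<in> u ` {..K}" if "a \<in> A" for a
    using p[of a] that unfolding A_def C_eq by blast
  have pW: "pC w \<in> set vs" if "w \<in> leaves C" for w using pC[OF that] vs(3) by simp
  have ix_vs: "0 < ix x \<and> ix x < K" if "x \<in> set vs" for x
  proof -
    have x: "u (ix x) = x" "ix x \<le> K" using u_ix[of x] that u_img by auto
    have "ix x \<noteq> 0" "ix x \<noteq> K" using x(1) u_ends wvs that by metis+
    then show ?thesis using x(2) by simp
  qed
  \<comment> \<open>A leaf of \<open>C\<close> survived the first removal, so it has a further
    neighbour in \<open>G\<close> besides its single one in \<open>C\<close>, and that neighbour was
    removed as a leaf.\<close>
  have has_leaf: "\<exists>f. f \<in> leaves G \<and> p f = w" if "w \<in> leaves C" for w
  proof -
    have wC: "w \<in> verts G" "w \<notin> leaves G" "w \<in> verts C" using that lv vC by auto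
    have "card {x. (w, x) \<in> arcs_ends G} \<noteq> 1"
      using wC by (simp add: leaves_def out_degree_eq_card_successors)
    then have "{x. (w, x) \<in> arcs_ends G} \<noteq> {pC w}" by auto
    moreover have "(w, pC w) \<in> arcs_ends G" using pC_iff[OF that] eC by blast
    ultimately obtain y where y: "(w, y) \<in> arcs_ends G" "y \<noteq> pC w" by blast
    then have "(w, y) \<notin> arcs_ends C" using pC_iff[OF that] by blast
    moreover have "y \<in> verts G" using adj_in_verts[OF y(1)] by simp
    ultimately have yL: "y \<in> leaves G" using eC y(1) wC(3) vC by blast
    then have "p y = w" using p_iff[OF yL] sym[OF y(1)] by simp
    then show ?thesis using yL by blast
  qed
  interpret lobster_skeleton K A W F pos p
  proof
    have "finite (leaves G)" "finite (verts C)" using lv(1) vC finite_verts by (auto intro: finite_subset)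
    then show "finite A" "finite W" "finite F" using AF(1,2) W_C(1) by (auto intro: finite_subset)
    show "A \<inter> W = {}" "W \<inter> F = {}" using AF W_C CL by blast+
    show "A \<inter> F = {}" by (rule AF)
    show "2 \<le> K" using k unfolding K_def by linarith
    show "pos a \<le> K" if "a \<in> A" for a
      using u_ix(2)[OF pA[OF that]] that AF by (auto simp: pos_def)
    show "0 < pos w \<and> pos w < K" if "w \<in> W" for w
    proof -
      have "w \<notin> leaves G" using that W_C CL by blast
      then show ?thesis using ix_vs[OF pW] that W_C by (auto simp: pos_def)
    qed
    show "p f \<in> W" if "f \<in> F" for f using that by (simp add: F_def)
    show "\<exists>f. f \<in> F \<and> p f = w" if "w \<in> W" for w
      using has_leaf[of w] that W_C by (auto simp: F_def)
    have end_leaf: "\<exists>a. a \<in> A \<and> pos a = i" if "u i \<in> leaves C" "i \<le> K" for i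
    proof -
      obtain a where a: "a \<in> leaves G" "p a = u i" using has_leaf[OF \<open>u i \<in> leaves C\<close>] by blast
      moreover have "u i \<notin> W" using u_C(2) \<open>i \<le> K\<close> by blast
      ultimately show ?thesis using ix[OF \<open>i \<le> K\<close>] by (auto simp: A_def pos_def intro!: exI[of _ a])
    qed
    show "\<exists>a. a \<in> A \<and> pos a = 0" "\<exists>a. a \<in> A \<and> pos a = K"
      using end_leaf[of 0] end_leaf[of K] w01 u_ends by simp_all
  qed
  have u_AWF: "u ` {..K} \<inter> (A \<union> W \<union> F) = {}" using u_C AF CL by blast
  have par_u: "par (u j) = u (Suc j)" if "j < K" for j
  proof -
    have "u j \<in> u ` {..K}" using that by simp
    then have "u j \<notin> leaves G" "u j \<notin> W" using u_C CL by blast+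
    then show ?thesis using ix[of j] that by (simp add: par_def)
  qed
  have par_W: "par w = pC w" if "w \<in> W" for w
    using that W_C CL by (auto simp: par_def)
  have par_leaf: "par f = p f" if "f \<in> leaves G" for f using that by (simp add: par_def)
  have par_AW: "par a = u (pos a)" if "a \<in> A \<union> W" for a
  proof (cases "a \<in> W")
    case True
    then have a: "a \<notin> leaves G" "a \<in> leaves C" using W_C CL by auto
    have "u (ix (pC a)) = pC a" using u_ix(1)[of "pC a"] pW[OF a(2)] u_img by blast
    then show ?thesis using a par_W[OF True] by (simp add: pos_def)
  next
    case False
    then have "a \<in> A" using that by blast
    then show ?thesis using par_leaf[of a] u_ix(1)[OF pA] AF by (auto simp: pos_def)
  qed
  have par_F: "par f = p f" if "f \<in> F" for f using that AF par_leaf by blast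
  obtain lab s where lab: "bij_betw lab E {1..int (card E)}" "\<And>v. s v \<in> {1, - 1 :: int}"
    "inj_on (\<lambda>v. (\<Sum>c | c \<in> E \<and> par c = v. s c * lab c) - (if v \<in> E then s v * lab v else 0)) (insert (u K) E)"
    using ex_rooted_labelling[OF inj u_AWF par_u par_AW par_F E_def] by blast
  have E_iff: "v \<in> E \<longleftrightarrow> (\<exists>j<K. v = u j) \<or> v \<in> leaves G \<or> v \<in> W" for v
    unfolding E_def AF(3)[symmetric] by blast
  have uK: "u ` {..K} = insert (u K) (u ` {..<K})"
    by (simp add: lessThan_Suc_atMost[symmetric] lessThan_Suc)
  have V: "verts G = insert (u K) E"
  proof -
    have "verts G = verts C \<union> leaves G" using vC lv by blast
    then show ?thesis unfolding C_eq E_def uK AF(3)[symmetric] by blast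
  qed
  have adj_u: "(u j, u (Suc j)) \<in> arcs_ends G" if j: "j < K" for j
  proof -
    have "j = 0 \<or> j = ?k \<or> (\<exists>i. j = Suc i \<and> Suc i < ?k)"
      using j unfolding K_def by (cases j) auto
    then consider "j = 0" | "j = ?k" | i where "j = Suc i" "Suc i < ?k" by blast
    then show ?thesis
    proof cases
      case 1
      then show ?thesis using w01(4) eC u_ends u_mid[OF k] by simp
    next
      case 2
      then have "u j = vs ! (?k - 1)" "u (Suc j) = w1" using k u_ends by (simp_all add: u_def K_def)
      then show ?thesis using w01(5) eC sym by simp
    next
      case 3
      then have "(u j, u (Suc j)) \<in> arcs_ends (remove_leaves C)"
        using u_mid[of i] u_mid[of "Suc i"] unfolding adj by auto
      then show ?thesis using eC by (simp add: arcs_ends_remove_leaves)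
    qed
  qed
  have par_adj: "(v, par v) \<in> arcs_ends G" if v: "v \<in> E" for v
  proof -
    consider j where "j < K" "v = u j" | "v \<in> leaves G" | "v \<in> W"
      using v E_iff by blast
    then show ?thesis
    proof cases
      case 1
      then show ?thesis using adj_u par_u by simp
    next
      case 2
      then show ?thesis using par_leaf p_iff by simp
    next
      case 3
      then have "(v, pC v) \<in> arcs_ends C" using pC_iff W_C by blast
      then show ?thesis using par_W[OF 3] eC by simp
    qed
  qed
  have par_all: "(x \<in> E \<and> y = par x) \<or> (y \<in> E \<and> x = par y)" if xy: "(x, y) \<in> arcs_ends G" for x y
  proof -
    have yx: "(y, x) \<in> arcs_ends G" using xy by (rule sym)
    have xyV: "x \<in> verts G" "y \<in> verts G" using xy yx by (auto dest: adj_in_verts)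
    have leaf_case: "a \<in> E \<and> b = par a" if "a \<in> leaves G" "(a, b) \<in> arcs_ends G" for a b
      using that p_iff par_leaf E_iff by simp
    have W_case: "a \<in> E \<and> b = par a" if "a \<in> W" "(a, b) \<in> arcs_ends C" for a b
      using that pC_iff[of a] par_W W_C(2) E_iff by auto
    \<comment> \<open>The edge at \<open>w0\<close> belongs to \<open>w0\<close> itself, whereas the
      edge at the root \<open>w1\<close> belongs to its neighbour \<open>u ?k\<close>.\<close>
    have end_case: "(a \<in> E \<and> b = par a) \<or> (b \<in> E \<and> a = par b)"
      if ab: "a = w0 \<or> a = w1" "(a, b) \<in> arcs_ends C" for a b
    proof (cases "a = w0")
      case True
      then have "b = u 1" using ab pC_iff[OF w01(1)] pC01 u_mid[OF k] by simp
      then show ?thesis using True par_u[of 0] u_ends by (auto simp: E_def K_def)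
    next
      case False
      then have "b = vs ! (?k - 1)" using ab pC_iff[OF w01(2)] pC01 by simp
      then have "b = u ?k" using k by (simp add: u_def)
      then show ?thesis using False ab(1) par_u[of ?k] u_ends by (auto simp: E_def K_def)
    qed
    have path_case: "(a \<in> E \<and> b = par a) \<or> (b \<in> E \<and> a = par b)"
      if ab: "a \<in> set vs" "b \<in> set vs" "(a, b) \<in> arcs_ends C" for a b
    proof -
      have "(a, b) \<in> arcs_ends (remove_leaves C)" using ab vs(3) by (simp add: arcs_ends_remove_leaves)
      then obtain i where i: "Suc i < ?k" "{a, b} = {vs ! i, vs ! Suc i}" unfolding adj by blast
      then have "u (Suc i) = vs ! i" "u (Suc (Suc i)) = vs ! Suc i" "Suc i < K" "Suc (Suc i) < K"
        using u_mid[of i] u_mid[of "Suc i"] by (auto simp: K_def)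
      moreover have "par (u (Suc i)) = u (Suc (Suc i))" using par_u calculation(3) by blast
      moreover have "vs ! i \<in> E" using calculation(1,3) E_iff by metis
      ultimately show ?thesis using i(2) by (auto simp: doubleton_eq_iff)
    qed
    show ?thesis
    proof (cases "x \<in> leaves G \<or> y \<in> leaves G")
      case True
      then show ?thesis using leaf_case xy yx by blast
    next
      case False
      then have inC: "x \<in> verts C" "y \<in> verts C" using xyV vC by auto
      then have xyC: "(x, y) \<in> arcs_ends C" "(y, x) \<in> arcs_ends C" using xy yx eC by auto
      have "x \<in> W \<or> (x = w0 \<or> x = w1) \<or> x \<in> set vs" "y \<in> W \<or> (y = w0 \<or> y = w1) \<or> y \<in> set vs"
        using inC unfolding C_eq u_img by blast+
      then show ?thesis using W_case[OF _ xyC(1)] W_case[OF _ xyC(2)] end_case[OF _ xyC(1)] end_case[OF _ xyC(2)]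
          path_case[OF _ _ xyC(1)] by metis
    qed
  qed
  have ends: "arcs_ends G = (\<lambda>v. (v, par v)) ` E \<union> (\<lambda>v. (par v, v)) ` E"
  proof
    show "arcs_ends G \<subseteq> (\<lambda>v. (v, par v)) ` E \<union> (\<lambda>v. (par v, v)) ` E"
      using par_all by auto
    show "(\<lambda>v. (v, par v)) ` E \<union> (\<lambda>v. (par v, v)) ` E \<subseteq> arcs_ends G"
      using par_adj sym by blast
  qed
  \<comment> \<open>Two steps towards the root end on the spine, and at a higher index than
    \<open>v\<close> if \<open>v\<close> is on the spine itself.\<close>
  have no2: "par (par v) \<noteq> v" if v: "v \<in> E" "par v \<in> E" for v
  proof -
    consider j where "j < K" "v = u j" | "v \<in> A \<union> W" | "v \<in> F" using v(1) E_iff AF(3) by blast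
    then show ?thesis
    proof cases
      case 1
      have "Suc j < K"
      proof (rule ccontr)
        assume "\<not> Suc j < K"
        then have "par v = u K" using 1 par_u by (metis Suc_lessI)
        moreover have "u K \<notin> E"
          using u_AWF inj_onD[OF inj, of K] unfolding E_def by fastforce
        ultimately show False using v(2) by simp
      qed
      then have "par (par v) = u (Suc (Suc j))" using 1 par_u by simp
      then show ?thesis using 1 inj_onD[OF inj, of "Suc (Suc j)" j] \<open>Suc j < K\<close> by auto
    next
      case 2
      then have pos: "pos v \<le> K" using pos_A pos_W by (metis UnE less_imp_le)
      have "par v = u (pos v)" using par_AW[OF 2] .
      moreover have "pos v \<noteq> K"
      proof
        assume "pos v = K"
        moreover have "u K \<notin> E"
          using u_AWF inj_onD[OF inj, of K] unfolding E_def by fastforce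
        ultimately show False using v(2) par_AW[OF 2] by simp
      qed
      ultimately have "par (par v) = u (Suc (pos v))" "Suc (pos v) \<le> K" using pos par_u by simp_all
      then show ?thesis using 2 u_AWF by (metis IntI UnCI atMost_iff empty_iff imageI)
    next
      case 3
      then have "par v \<in> W" using par_F own_F by simp
      then have "par (par v) \<in> set vs" using par_W pW W_C by auto
      moreover have "v \<notin> set vs" using 3 AF CL vs(3) by auto
      ultimately show ?thesis by metis
    qed
  qed
  have "E \<subseteq> verts G" unfolding V by blast
  then show ?thesis
    using gr ends no2 lab(1,2) lab(3)[folded V] by (intro ex_antimagic_orientation_rooted)
qed

end
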